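(* Let $\mathfrak{g}$ be a finite-dimensional reductive Lie algebra over $\mathbb{C}$. Let $\mathbf{x}$ be an element of $\mathfrak{g}_\infty$, $n$ a natural number, $\mathbf{G}_n$ the algebraic adjoint group of $\mathfrak{g}_n$, $x_0=x_{\mathrm{ss}}+x_{\mathrm{nil}}$ the Jordan decomposition of $x_0$, and $\mathfrak{s}=\mathfrak{g}^{x_{\mathrm{ss}}}$ the centralizer of $x_{\mathrm{ss}}$ in $\mathfrak{g}$. There exists an element $\tilde{\mathbf{x}}$ of $\mathfrak{s}_\infty\subset\mathfrak{g}_\infty$ such that $\tilde{x}_0=x_{\mathrm{nil}}$ and $\mathfrak{g}_n^{\tilde{\mathbf{x}}(n)}$ is $\mathbf{G}_n$-conjugate to $\mathfrak{g}_n^{\mathbf{x}(n)}$. Moreover, $\mathfrak{g}_n^{\tilde{\mathbf{x}}(n)}=\mathfrak{s}_n^{\tilde{\mathbf{x}}(n)}$. In particular, for all $0\leq m\leq n$, the $(m,n)$-modality of $\mathbf{x}$ as an element of $\mathfrak{g}_\infty$ is equal to the $(m,n)$-modality of $\tilde{\mathbf{x}}$ as an element of $\mathfrak{s}_\infty$.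
   Context: Natural numbers include $0$. For a finite-dimensional complex Lie algebra $\mathfrak{h}$, let $\mathfrak{h}_\infty=\mathfrak{h}\otimes\mathbb{C}[T]$ be the Lie algebra with bracket extended $\mathbb{C}[T]$-bilinearly; its elements are written $\mathbf{x}=\sum_{k\in\mathbb{N}}x_k\otimes T^k$ with $x_k\in\mathfrak{h}$ (finitely many nonzero). For $m\in\mathbb{N}$ let $\mathfrak{h}_m=\mathfrak{h}_\infty/(\mathfrak{h}\otimes T^{m+1}\mathbb{C}[T])$ (the $m$-th generalized Takiff Lie algebra; $\mathfrak{h}_0=\mathfrak{h}$), and let $\mathbf{x}(m)=(x_0,\dots,x_m)$ be the image of $\mathbf{x}$ in $\mathfrak{h}_m$. If $\mathfrak{s}\subset\mathfrak{g}$ is a subalgebra, then $\mathfrak{s}_\infty$ and $\mathfrak{s}_n$ are viewed as subalgebras of $\mathfrak{g}_\infty$ and $\mathfrak{g}_n$. For an element $z$ of a Lie algebra $\mathfrak{k}$, $\mathfrak{k}^z$ is its centralizer in $\mathfrak{k}$. For $m\le n$ in $\mathbb{N}$ and $\mathbf{x}\in\mathfrak{h}_\infty$, the $(m,n)$-modality of $\mathbf{x}$ as an element of $\mathfrak{h}_\infty$ is $$\operatorname{mod}_{m,n}(\mathbf{x})=\min_{\mathbf{y}\in\mathfrak{h}_\infty,\ \mathbf{y}(m)=\mathbf{x}(m)}\dim\mathfrak{h}_n^{\mathbf{y}(n)}-\dim\mathfrak{h}_m^{\mathbf{x}(m)}.$$ The Jordan decomposition of an element $x$ of a reductive Lie algebra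 $\mathfrak{g}$ is the unique decomposition $x=x_{\mathrm{ss}}+x_{\mathrm{nil}}$ with $[x_{\mathrm{ss}},x_{\mathrm{nil}}]=0$, $\operatorname{ad}x_{\mathrm{ss}}$ diagonalizable, and $x_{\mathrm{nil}}\in[\mathfrak{g},\mathfrak{g}]$ with $\operatorname{ad}x_{\mathrm{nil}}$ nilpotent; $x_{\mathrm{ss}}$ is the semisimple part and $x_{\mathrm{nil}}$ the nilpotent part. The algebraic adjoint group of a finite-dimensional complex Lie algebra $\mathfrak{h}$ is the smallest algebraic subgroup of $\mathrm{GL}(\mathfrak{h})$ whose Lie algebra contains $\operatorname{ad}\mathfrak{h}$; it acts on $\mathfrak{h}$ by Lie algebra automorphisms. Two subspaces $A,B$ of $\mathfrak{g}_n$ are $\mathbf{G}_n$-conjugate if $g\cdot A=B$ for some $g\in\mathbf{G}_n$.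
   Formalization: In both occurrences of the centralizer of x̃(n) in g_n, x̃ is replaced by x_ss + x̃. As printed the claim fails: for g = sl_2, n = 0, x = h, x̃(0) = 0 has centralizer of dimension 3, but that of h has dimension 1. If x_ss is central, both versions agree. *)

theory Defs
  imports
    Complex_Main
    "HOL-Computational_Algebra.Polynomial"
    "HOL-Algebra.Bij"
begin

section \<open>Complex Lie algebras\<close>

text \<open>
  A Lie algebra is a subspace \<open>lie_space L\<close> of a complex vector space given by a type, with
  the addition of the type.  The values of \<open>lie_br L\<close> outside \<open>lie_space L\<close> are irrelevant.
  With an explicit carrier, a subalgebra is obtained by just changing \<open>lie_space\<close>.
\<close>

record 'a lie_alg =
  lie_space :: "'a set"
  lie_scale :: "complex \<Rightarrow> 'a \<Rightarrow> 'a"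
  lie_br :: "'a \<Rightarrow> 'a \<Rightarrow> 'a"

abbreviation lie_span :: "'a::ab_group_add lie_alg \<Rightarrow> 'a set \<Rightarrow> 'a set" where
  "lie_span L \<equiv> module.span (lie_scale L)"

abbreviation lie_subspace :: "'a::ab_group_add lie_alg \<Rightarrow> 'a set \<Rightarrow> bool" where
  "lie_subspace L \<equiv> module.subspace (lie_scale L)"

abbreviation lie_dim :: "'a::ab_group_add lie_alg \<Rightarrow> 'a set \<Rightarrow> nat" where
  "lie_dim L \<equiv> vector_space.dim (lie_scale L)"

locale fd_lie_algebra =
  fixes L :: "'a::ab_group_add lie_alg"
  assumes vector_space: "vector_space (lie_scale L)"
    and subspace: "lie_subspace L (lie_space L)"
    and finite_dim: "\<exists>B. finite B \<and> lie_span L B = lie_space L"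
    and br_closed: "x \<in> lie_space L \<Longrightarrow> y \<in> lie_space L \<Longrightarrow> lie_br L x y \<in> lie_space L"
    and br_add_left: "x \<in> lie_space L \<Longrightarrow> y \<in> lie_space L \<Longrightarrow> z \<in> lie_space L \<Longrightarrow>
          lie_br L (x + y) z = lie_br L x z + lie_br L y z"
    and br_add_right: "x \<in> lie_space L \<Longrightarrow> y \<in> lie_space L \<Longrightarrow> z \<in> lie_space L \<Longrightarrow>
          lie_br L x (y + z) = lie_br L x y + lie_br L x z"
    and br_scale_left: "x \<in> lie_space L \<Longrightarrow> y \<in> lie_space L \<Longrightarrow>
          lie_br L (lie_scale L c x) y = lie_scale L c (lie_br L x y)"
    and br_scale_right: "x \<in> lie_space L \<Longrightarrow> y \<in> lie_space L \<Longrightarrow>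
          lie_br L x (lie_scale L c y) = lie_scale L c (lie_br L x y)"
    and br_self: "x \<in> lie_space L \<Longrightarrow> lie_br L x x = 0"
    and jacobi: "x \<in> lie_space L \<Longrightarrow> y \<in> lie_space L \<Longrightarrow> z \<in> lie_space L \<Longrightarrow>
          lie_br L x (lie_br L y z) + lie_br L y (lie_br L z x) + lie_br L z (lie_br L x y) = 0"

definition lie_centralizer :: "'a::ab_group_add lie_alg \<Rightarrow> 'a \<Rightarrow> 'a set" where
  "lie_centralizer L z = {y \<in> lie_space L. lie_br L z y = 0}"

definition centralizer_subalgebra :: "'a::ab_group_add lie_alg \<Rightarrow> 'a \<Rightarrow> 'a lie_alg" where
  "centralizer_subalgebra L z = L\<lparr>lie_space := lie_centralizer L z\<rparr>"

definition lie_center :: "'a::ab_group_add lie_alg \<Rightarrow> 'a set" where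
  "lie_center L = {z \<in> lie_space L. \<forall>y\<in>lie_space L. lie_br L z y = 0}"

definition lie_ideal :: "'a::ab_group_add lie_alg \<Rightarrow> 'a set \<Rightarrow> bool" where
  "lie_ideal L I \<longleftrightarrow> I \<subseteq> lie_space L \<and> lie_subspace L I \<and>
     (\<forall>x\<in>lie_space L. \<forall>y\<in>I. lie_br L x y \<in> I)"

definition br_span :: "'a::ab_group_add lie_alg \<Rightarrow> 'a set \<Rightarrow> 'a set \<Rightarrow> 'a set" where
  "br_span L A B = lie_span L {lie_br L a b | a b. a \<in> A \<and> b \<in> B}"

definition lie_solvable :: "'a::ab_group_add lie_alg \<Rightarrow> 'a set \<Rightarrow> bool" where
  "lie_solvable L I \<longleftrightarrow> (\<exists>k. ((\<lambda>J. br_span L J J) ^^ k) I = {0})"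

text \<open>
  The radical is the sum of all solvable ideals, which is the largest one in finite dimension.
\<close>

definition lie_radical :: "'a::ab_group_add lie_alg \<Rightarrow> 'a set" where
  "lie_radical L = lie_span L (\<Union>{I. lie_ideal L I \<and> lie_solvable L I})"

definition reductive :: "'a::ab_group_add lie_alg \<Rightarrow> bool" where
  "reductive L \<longleftrightarrow> lie_radical L = lie_center L"

definition ad_diagonalizable :: "'a::ab_group_add lie_alg \<Rightarrow> 'a \<Rightarrow> bool" where
  "ad_diagonalizable L z \<longleftrightarrow>
     (\<exists>B. \<not> module.dependent (lie_scale L) B \<and> lie_span L B = lie_space L \<and>
          (\<forall>b\<in>B. \<exists>c. lie_br L z b = lie_scale L c b))"

definition ad_nilpotent :: "'a::ab_group_add lie_alg \<Rightarrow> 'a \<Rightarrow> bool" where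
  "ad_nilpotent L z \<longleftrightarrow> (\<exists>k. \<forall>y\<in>lie_space L. (lie_br L z ^^ k) y = 0)"

definition jordan_decomposition :: "'a::ab_group_add lie_alg \<Rightarrow> 'a \<Rightarrow> 'a \<Rightarrow> 'a \<Rightarrow> bool" where
  "jordan_decomposition L x xss xnil \<longleftrightarrow>
     xss \<in> lie_space L \<and> xnil \<in> br_span L (lie_space L) (lie_space L) \<and>
     x = xss + xnil \<and> lie_br L xss xnil = 0 \<and>
     ad_diagonalizable L xss \<and> ad_nilpotent L xnil"


section \<open>Generalized Takiff algebras\<close>

text \<open>
  The element \<open>\<Sum>k. x\<^sub>k \<otimes> T\<^sup>k\<close> is the polynomial with coefficients \<open>x\<^sub>k\<close>.
\<close>

definition current :: "'a::ab_group_add lie_alg \<Rightarrow> 'a poly lie_alg" where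
  "current L = \<lparr>
     lie_space = {p. \<forall>k. coeff p k \<in> lie_space L},
     lie_scale = (\<lambda>c. map_poly (lie_scale L c)),
     lie_br = (\<lambda>p q. \<Sum>i\<le>degree p. \<Sum>j\<le>degree q. monom (lie_br L (coeff p i) (coeff q j)) (i + j))\<rparr>"

text \<open>
  The quotient of \<open>current L\<close> by the multiples of \<open>T\<^sup>m\<^sup>+\<^sup>1\<close> is realised on the representatives
  \<open>(x\<^sub>0, \<dots>, x\<^sub>m)\<close> of degree at most \<open>m\<close>; \<open>jet m\<close> is the quotient map.  The lemmas below
  justify this.
\<close>

definition jet :: "nat \<Rightarrow> 'a::ab_group_add poly \<Rightarrow> 'a poly" where
  "jet m p = poly_cutoff (Suc m) p"

definition takiff :: "'a::ab_group_add lie_alg \<Rightarrow> nat \<Rightarrow> 'a poly lie_alg" where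
  "takiff L m = \<lparr>
     lie_space = {p \<in> lie_space (current L). degree p \<le> m},
     lie_scale = lie_scale (current L),
     lie_br = (\<lambda>p q. jet m (lie_br (current L) p q))\<rparr>"

lemma coeff_jet: "coeff (jet m p) k = (if k \<le> m then coeff p k else 0)"
  by (auto simp: jet_def coeff_poly_cutoff)

lemma jet_eq_0_iff: "jet m p = 0 \<longleftrightarrow> (\<forall>k\<le>m. coeff p k = 0)"
  by (auto simp: poly_eq_iff coeff_jet)

lemma jet_add: "jet m (p + q) = jet m p + jet m q"
  by (auto simp: poly_eq_iff coeff_jet)

context fd_lie_algebra
begin

lemma zero_mem: "0 \<in> lie_space L"
  using subspace vector_space module.subspace_0 by (metis module_iff_vector_space)

lemma br_0_left: "x \<in> lie_space L \<Longrightarrow> lie_br L 0 x = 0"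
  using br_add_left[OF zero_mem zero_mem, of x] by simp

lemma br_0_right: "x \<in> lie_space L \<Longrightarrow> lie_br L x 0 = 0"
  using br_add_right[OF _ zero_mem zero_mem, of x] by simp

lemma scale_0: "lie_scale L c 0 = 0"
  using vector_space module.scale_zero_right by (metis module_iff_vector_space)

lemma coeff_current_scale: "coeff (lie_scale (current L) c p) k = lie_scale L c (coeff p k)"
  by (simp add: current_def coeff_map_poly scale_0)

lemma coeff_current_br:
  assumes p: "p \<in> lie_space (current L)" and q: "q \<in> lie_space (current L)"
  shows "coeff (lie_br (current L) p q) k = (\<Sum>i\<le>k. lie_br L (coeff p i) (coeff q (k - i)))"
proof -
  let ?b = "\<lambda>i j. lie_br L (coeff p i) (coeff q j)"
  have mem: "coeff p i \<in> lie_space L" "coeff q i \<in> lie_space L" for i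
    using p q by (auto simp: current_def)
  have z: "?b i j = 0" if "i > degree p \<or> j > degree q" for i j
    using that mem by (auto simp: coeff_eq_0 br_0_left br_0_right)
  have inner: "(\<Sum>j\<le>degree q. if i + j = k then ?b i j else 0)
      = (if i \<le> k then ?b i (k - i) else 0)" for i
  proof (cases "i \<le> k")
    case True
    then have "(\<Sum>j\<le>degree q. if i + j = k then ?b i j else 0)
      = (\<Sum>j\<le>degree q. if j = k - i then ?b i j else 0)"
      by (intro sum.cong) auto
    then show ?thesis using True z by (auto simp: not_le)
  qed (auto intro!: sum.neutral)
  have "coeff (lie_br (current L) p q) k
      = (\<Sum>i\<le>degree p. \<Sum>j\<le>degree q. if i + j = k then ?b i j else 0)"
    by (simp add: current_def coeff_sum)
  also have "\<dots> = (\<Sum>i\<le>degree p. if i \<le> k then ?b i (k - i) else 0)"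
    by (simp add: inner)
  also have "\<dots> = (\<Sum>i\<in>{..degree p} \<inter> {..k}. ?b i (k - i))"
    by (simp add: sum.If_cases atMost_def)
  also have "\<dots> = (\<Sum>i\<le>k. ?b i (k - i))"
  proof (rule sum.mono_neutral_left)
    show "\<forall>i\<in>{..k} - {..degree p} \<inter> {..k}. ?b i (k - i) = 0"
    proof
      fix i assume "i \<in> {..k} - {..degree p} \<inter> {..k}"
      then have "i > degree p" by auto
      then show "?b i (k - i) = 0" by (simp add: z)
    qed
  qed auto
  finally show ?thesis .
qed

lemma jet_mem: "p \<in> lie_space (current L) \<Longrightarrow> jet m p \<in> lie_space (takiff L m)"
  by (auto simp: takiff_def current_def coeff_jet zero_mem intro!: degree_le)

lemma jet_image: "jet m ` lie_space (current L) = lie_space (takiff L m)"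
proof -
  have "p = jet m p" if "degree p \<le> m" for p :: "'a poly"
    using that by (auto simp: poly_eq_iff coeff_jet intro: coeff_eq_0)
  then show ?thesis
    using jet_mem by (fastforce simp: takiff_def)
qed

lemma jet_scale: "jet m (lie_scale (current L) c p) = lie_scale (takiff L m) c (jet m p)"
  by (auto simp: poly_eq_iff takiff_def coeff_jet coeff_current_scale scale_0)

lemma jet_br:
  assumes "p \<in> lie_space (current L)" "q \<in> lie_space (current L)"
  shows "jet m (lie_br (current L) p q) = lie_br (takiff L m) (jet m p) (jet m q)"
proof -
  have "jet m p \<in> lie_space (current L)" "jet m q \<in> lie_space (current L)"
    using assms jet_mem by (auto simp: takiff_def)
  then show ?thesis
    using assms by (auto simp: takiff_def poly_eq_iff coeff_jet coeff_current_br intro!: sum.cong)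
qed

end

text \<open>An infimum over a nonempty set of natural numbers is a minimum.\<close>

definition modality :: "'a::ab_group_add lie_alg \<Rightarrow> nat \<Rightarrow> nat \<Rightarrow> 'a poly \<Rightarrow> int" where
  "modality L m n x =
     int (INF y \<in> {y \<in> lie_space (current L). jet m y = jet m x}.
            lie_dim (takiff L n) (lie_centralizer (takiff L n) (jet n y)))
     - int (lie_dim (takiff L m) (lie_centralizer (takiff L m) (jet m x)))"


section \<open>The algebraic adjoint group\<close>

text \<open>
  Endomorphisms are taken as extensional functions on \<open>lie_space L\<close>, as in \<^const>\<open>BijGroup\<close>.
\<close>

definition lie_End :: "'a::ab_group_add lie_alg \<Rightarrow> ('a \<Rightarrow> 'a) set" where
  "lie_End L = {f \<in> lie_space L \<rightarrow>\<^sub>E lie_space L.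
     (\<forall>u\<in>lie_space L. \<forall>v\<in>lie_space L. f (u + v) = f u + f v) \<and>
     (\<forall>c. \<forall>v\<in>lie_space L. f (lie_scale L c v) = lie_scale L c (f v))}"

definition lie_GL :: "'a::ab_group_add lie_alg \<Rightarrow> ('a \<Rightarrow> 'a) set" where
  "lie_GL L = lie_End L \<inter> Bij (lie_space L)"

definition lie_ad :: "'a::ab_group_add lie_alg \<Rightarrow> 'a \<Rightarrow> 'a \<Rightarrow> 'a" where
  "lie_ad L z = restrict (lie_br L z) (lie_space L)"

text \<open>
  The polynomial functions on \<open>lie_End L\<close> are generated by the matrix coefficients
  \<open>f \<mapsto> \<phi> (f v)\<close>.
\<close>

inductive_set poly_funs :: "'a::ab_group_add lie_alg \<Rightarrow> (('a \<Rightarrow> 'a) \<Rightarrow> complex) set"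
  for L :: "'a lie_alg" where
  const: "(\<lambda>_. c) \<in> poly_funs L"
| coord: "v \<in> lie_space L \<Longrightarrow> Vector_Spaces.linear (lie_scale L) (*) \<phi> \<Longrightarrow>
    (\<lambda>f. \<phi> (f v)) \<in> poly_funs L"
| add: "P \<in> poly_funs L \<Longrightarrow> Q \<in> poly_funs L \<Longrightarrow> (\<lambda>f. P f + Q f) \<in> poly_funs L"
| mult: "P \<in> poly_funs L \<Longrightarrow> Q \<in> poly_funs L \<Longrightarrow> (\<lambda>f. P f * Q f) \<in> poly_funs L"

text \<open>
  Inverting the determinant gives no further closed subsets of \<open>lie_GL L\<close>.
\<close>

definition algebraic_subgroup :: "'a::ab_group_add lie_alg \<Rightarrow> ('a \<Rightarrow> 'a) set \<Rightarrow> bool" where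
  "algebraic_subgroup L G \<longleftrightarrow>
     G \<subseteq> lie_GL L \<and> subgroup G (BijGroup (lie_space L)) \<and>
     (\<exists>Ps. Ps \<subseteq> poly_funs L \<and> G = {f \<in> lie_GL L. \<forall>P\<in>Ps. P f = 0})"

text \<open>
  The Lie algebra of an algebraic subgroup is its Zariski tangent space at the identity: the
  endomorphisms \<open>X\<close> such that the differential at the identity, in the direction \<open>X\<close>, of every
  polynomial function vanishing on \<open>G\<close> is zero.
\<close>

definition group_lie_algebra ::
  "'a::ab_group_add lie_alg \<Rightarrow> ('a \<Rightarrow> 'a) set \<Rightarrow> ('a \<Rightarrow> 'a) set" where
  "group_lie_algebra L G = {X \<in> lie_End L. \<forall>P\<in>poly_funs L. (\<forall>f\<in>G. P f = 0) \<longrightarrow>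
     ((\<lambda>t. P (\<lambda>v\<in>lie_space L. v + lie_scale L t (X v))) has_field_derivative 0) (at 0)}"

text \<open>
  The intersection is itself algebraic with Lie algebra containing \<open>ad L\<close> (characteristic zero),
  so it is the smallest such group.
\<close>

definition algebraic_adjoint_group :: "'a::ab_group_add lie_alg \<Rightarrow> ('a \<Rightarrow> 'a) set" where
  "algebraic_adjoint_group L =
     \<Inter>{G. algebraic_subgroup L G \<and> lie_ad L ` lie_space L \<subseteq> group_lie_algebra L G}"

definition adjoint_conjugate :: "'a::ab_group_add lie_alg \<Rightarrow> 'a set \<Rightarrow> 'a set \<Rightarrow> bool" where
  "adjoint_conjugate L A B \<longleftrightarrow> (\<exists>a\<in>algebraic_adjoint_group L. a ` A = B)"

end

theory Submission
  imports Defs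
begin

text \<open>
  Write \<open>\<ss> = \<gg>\<^sup>x\<^sup>s\<^sup>s\<close>.  Because \<open>ad xss\<close> is diagonalizable, \<open>\<gg>\<close> is the sum of its kernel \<open>\<ss>\<close> and its image,
  and on the image \<open>ad x\<^sub>0\<close> is invertible, being an invertible operator plus the commuting nilpotent
  \<open>ad xnil\<close>.  Two consequences carry the whole proof: \<open>\<gg> = \<ss> + [x\<^sub>0, \<gg>]\<close>
  (\<open>centralizer_plus_ad_image\<close>), and \<open>[x\<^sub>0, b] \<in> \<ss>\<close> forces \<open>b \<in> \<ss>\<close>
  (\<open>mem_centralizer_if_br_mem_centralizer\<close>).

  By the first one the coefficients of \<open>\<^bold>x\<close> can be moved into \<open>\<ss>\<close> one degree at a time: for \<open>k \<ge> 1\<close>,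
  \<open>exp (ad (y T\<^sup>k))\<close> leaves the coefficients below degree \<open>k\<close> alone and adds \<open>[y, x\<^sub>0]\<close> to the one in
  degree \<open>k\<close>, and a suitable \<open>y\<close> puts that coefficient into \<open>\<ss>\<close> (\<open>normal_form\<close>).  The result has the
  form \<open>xss + \<^bold>x'\<close> with \<open>\<^bold>x'\<close> in the currents of \<open>\<ss>\<close> and constant term \<open>xnil\<close>.  These exponentials lie
  in the algebraic adjoint group: the Lie algebra of an algebraic group \<open>G\<close> is defined by
  first-order vanishing at the identity, left translation carries this to all of \<open>G\<close>, so the left
  invariant derivation given by \<open>X\<close> preserves the ideal of \<open>G\<close>.  Hence, for \<open>X\<close> nilpotent and \<open>P\<close> in the
  ideal, the polynomial \<open>P (exp (t X))\<close> in \<open>t\<close> has all derivatives zero at \<open>t = 0\<close>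
  (\<open>nilexp_in_algebraic_subgroup\<close>).

  By the second one, an element that commutes with \<open>xss + \<^bold>x'\<close> modulo \<open>T\<^sup>n\<^sup>+\<^sup>1\<close> has all its coefficients
  in \<open>\<ss>\<close>, where \<open>xss\<close> acts by zero (\<open>centralizer_eq\<close>).

  For the modalities, one keeps track of the fact that all automorphisms in sight respect the
  filtration by powers of \<open>T\<close>.  They therefore induce automorphisms at each level \<open>m \<le> n\<close>, and they
  match the elements with the \<open>m\<close>-jet of \<open>\<^bold>x\<close> to those with the \<open>m\<close>-jet of \<open>xss + \<^bold>x'\<close>; the latter can in
  turn be moved into \<open>xss\<close> plus the currents of \<open>\<ss>\<close> without changing their \<open>m\<close>-jets
  (\<open>modality_eq\<close>).
\<close>

section \<open>Exponentials of nilpotent endomorphisms\<close>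

sublocale fd_lie_algebra \<subseteq> V: vector_space "lie_scale L"
  by (rule vector_space)

text \<open>
  The bound \<open>2 * N\<close> makes the triangle on the left contain the square on the right.  Both the
  one-parameter group law and the compatibility of the exponential with brackets are instances.
\<close>

lemma sum_Cauchy_product_truncated:
  fixes g :: "nat \<Rightarrow> nat \<Rightarrow> 'b::comm_monoid_add"
  assumes z: "\<And>i j. N \<le> i \<or> N \<le> j \<Longrightarrow> g i j = 0"
  shows "(\<Sum>k<2*N. \<Sum>i\<le>k. g i (k - i)) = (\<Sum>i<N. \<Sum>j<N. g i j)"
proof -
  have "finite {(i::nat, j). i + j < 2 * N}"
    by (rule finite_subset[of _ "{..<2*N} \<times> {..<2*N}"]) auto
  then have "(\<Sum>(i,j)\<in>{..<N} \<times> {..<N}. g i j) = (\<Sum>(i,j)\<in>{(i,j). i + j < 2*N}. g i j)"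
    by (intro sum.mono_neutral_left) (auto intro: z)
  then show ?thesis
    by (simp add: sum.triangle_reindex sum.cartesian_product)
qed

context fd_lie_algebra
begin

lemmas mem_add = V.subspace_add[OF subspace]
lemmas mem_diff = V.subspace_diff[OF subspace]
lemmas mem_neg = V.subspace_neg[OF subspace]
lemmas mem_scale = V.subspace_scale[OF subspace]
lemmas mem_sum = V.subspace_sum[OF subspace]

lemma End_mem: "f \<in> lie_End L \<Longrightarrow> v \<in> lie_space L \<Longrightarrow> f v \<in> lie_space L"
  by (auto simp: lie_End_def)

lemma End_add: "f \<in> lie_End L \<Longrightarrow> u \<in> lie_space L \<Longrightarrow> v \<in> lie_space L \<Longrightarrow> f (u + v) = f u + f v"
  by (auto simp: lie_End_def)

lemma End_scale: "f \<in> lie_End L \<Longrightarrow> v \<in> lie_space L \<Longrightarrow> f (lie_scale L c v) = lie_scale L c (f v)"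
  by (auto simp: lie_End_def)

lemma End_0: "f \<in> lie_End L \<Longrightarrow> f 0 = 0"
  using End_add[of f 0 0] zero_mem by simp

lemma End_sum:
  assumes f: "f \<in> lie_End L" and "\<And>i. i \<in> A \<Longrightarrow> v i \<in> lie_space L"
  shows "f (\<Sum>i\<in>A. v i) = (\<Sum>i\<in>A. f (v i))"
  using assms(2) by (induction A rule: infinite_finite_induct) (auto simp: End_0[OF f] End_add[OF f] mem_sum)

lemma End_pow_mem: "f \<in> lie_End L \<Longrightarrow> v \<in> lie_space L \<Longrightarrow> (f ^^ k) v \<in> lie_space L"
  by (induction k) (auto simp: End_mem)

lemma End_pow_add:
  "f \<in> lie_End L \<Longrightarrow> u \<in> lie_space L \<Longrightarrow> v \<in> lie_space L \<Longrightarrow> (f ^^ k) (u + v) = (f ^^ k) u + (f ^^ k) v"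
  by (induction k) (auto simp: End_add End_pow_mem)

lemma End_pow_scale:
  "f \<in> lie_End L \<Longrightarrow> v \<in> lie_space L \<Longrightarrow> (f ^^ k) (lie_scale L c v) = lie_scale L c ((f ^^ k) v)"
  by (induction k) (auto simp: End_scale End_pow_mem)

lemma End_pow_0: "f \<in> lie_End L \<Longrightarrow> (f ^^ k) 0 = 0"
  by (induction k) (auto simp: End_0)

lemma End_compose: "f \<in> lie_End L \<Longrightarrow> g \<in> lie_End L \<Longrightarrow> compose (lie_space L) f g \<in> lie_End L"
  unfolding lie_End_def by (auto simp: compose_def PiE_iff mem_add mem_scale)

lemma one_plus_End:
  "f \<in> lie_End L \<Longrightarrow> (\<lambda>v\<in>lie_space L. v + lie_scale L t (f v)) \<in> lie_End L"
  by (auto simp: lie_End_def PiE_iff mem_add mem_scale V.scale_right_distrib algebra_simps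
      V.scale_left_commute)

lemma lie_ad_End: "z \<in> lie_space L \<Longrightarrow> lie_ad L z \<in> lie_End L"
  by (auto simp: lie_End_def lie_ad_def br_closed mem_add mem_scale br_add_right br_scale_right)

lemma br_neg_right: "x \<in> lie_space L \<Longrightarrow> y \<in> lie_space L \<Longrightarrow> lie_br L x (- y) = - lie_br L x y"
  using br_scale_right[of x y "-1"] by simp

lemma br_diff_right:
  "x \<in> lie_space L \<Longrightarrow> y \<in> lie_space L \<Longrightarrow> z \<in> lie_space L \<Longrightarrow>
    lie_br L x (y - z) = lie_br L x y - lie_br L x z"
  using br_add_right[of x y "- z"] by (simp add: br_neg_right mem_neg)

lemma br_sum_left:
  assumes "y \<in> lie_space L" and "\<And>i. i \<in> A \<Longrightarrow> v i \<in> lie_space L"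
  shows "lie_br L (\<Sum>i\<in>A. v i) y = (\<Sum>i\<in>A. lie_br L (v i) y)"
  using assms(2) by (induction A rule: infinite_finite_induct)
    (auto simp: br_0_left assms(1) br_add_left mem_sum)

lemma br_sum_right:
  assumes "y \<in> lie_space L" and "\<And>i. i \<in> A \<Longrightarrow> v i \<in> lie_space L"
  shows "lie_br L y (\<Sum>i\<in>A. v i) = (\<Sum>i\<in>A. lie_br L y (v i))"
  using assms(2) by (induction A rule: infinite_finite_induct)
    (auto simp: br_0_right assms(1) br_add_right mem_sum)

lemma br_anticommute:
  assumes "x \<in> lie_space L" "y \<in> lie_space L"
  shows "lie_br L x y = - lie_br L y x"
proof -
  have "lie_br L (x + y) (x + y) = 0"
    using assms by (intro br_self mem_add)
  then have "lie_br L x y + lie_br L y x = 0"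
    using assms by (simp add: br_add_left br_add_right mem_add br_self[OF assms(1)]
        br_self[OF assms(2)] add.commute)
  then show ?thesis
    by (simp add: eq_neg_iff_add_eq_0)
qed

lemma br_derivation:
  assumes "z \<in> lie_space L" "u \<in> lie_space L" "v \<in> lie_space L"
  shows "lie_br L z (lie_br L u v) = lie_br L (lie_br L z u) v + lie_br L u (lie_br L z v)"
proof -
  have "lie_br L u (lie_br L v z) = - lie_br L u (lie_br L z v)"
    using assms br_anticommute[of v z] by (simp add: br_neg_right br_closed)
  moreover have "lie_br L v (lie_br L z u) = - lie_br L (lie_br L z u) v"
    using assms br_anticommute[of v "lie_br L z u"] by (simp add: br_closed)
  ultimately show ?thesis
    using jacobi[OF assms] by (simp only: add_uminus_conv_diff diff_eq_eq eq_diff_eq) simp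
qed

end

text \<open>
  The series is cut off by the parameter \<open>N\<close>, for which \<open>X\<^sup>N = 0\<close> is assumed where it matters; the
  time \<open>t\<close> is kept so that \<open>t \<mapsto> exp (t X)\<close> is available as a polynomial curve.
\<close>

definition nilexp :: "'a::ab_group_add lie_alg \<Rightarrow> nat \<Rightarrow> ('a \<Rightarrow> 'a) \<Rightarrow> complex \<Rightarrow> 'a \<Rightarrow> 'a" where
  "nilexp L N X t = (\<lambda>v\<in>lie_space L. \<Sum>k<N. lie_scale L (t ^ k / fact k) ((X ^^ k) v))"

locale nilpotent_endomorphism = fd_lie_algebra L for L :: "'a::ab_group_add lie_alg" +
  fixes X :: "'a \<Rightarrow> 'a" and N :: nat
  assumes X: "X \<in> lie_End L"
    and nil: "v \<in> lie_space L \<Longrightarrow> (X ^^ N) v = 0"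
begin

lemma nil_ge: "v \<in> lie_space L \<Longrightarrow> N \<le> k \<Longrightarrow> (X ^^ k) v = 0"
  using nil[of v] End_pow_0[OF X, of "k - N"] funpow_add[of "k - N" N X] by simp

lemma nilexp_mem: "v \<in> lie_space L \<Longrightarrow> nilexp L N X t v \<in> lie_space L"
  by (auto simp: nilexp_def intro!: mem_sum mem_scale End_pow_mem X)

lemma nilexp_End: "nilexp L N X t \<in> lie_End L"
  unfolding lie_End_def
  by (auto simp: nilexp_mem)
    (auto simp: nilexp_def mem_add mem_scale End_pow_add X End_pow_scale V.scale_right_distrib
      sum.distrib V.scale_sum_right mult.commute)

lemma nilexp_0:
  assumes v: "v \<in> lie_space L"
  shows "nilexp L N X 0 v = v"
proof (cases N)
  case 0
  then show ?thesis using nil[OF v] v by (simp add: nilexp_def)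
next
  case (Suc M)
  then show ?thesis using v by (simp add: nilexp_def sum.lessThan_Suc_shift del: sum.lessThan_Suc)
qed

lemma nilexp_add:
  assumes v: "v \<in> lie_space L"
  shows "nilexp L N X s (nilexp L N X t v) = nilexp L N X (s + t) v"
proof -
  let ?g = "\<lambda>i j. lie_scale L (s ^ i / fact i * (t ^ j / fact j)) ((X ^^ (i + j)) v)"
  have "(X ^^ i) (nilexp L N X t v) = (\<Sum>j<N. lie_scale L (t ^ j / fact j) ((X ^^ (i + j)) v))" for i
  proof -
    have *: "(X ^^ i) (\<Sum>j\<in>A. lie_scale L (t ^ j / fact j) ((X ^^ j) v))
        = (\<Sum>j\<in>A. lie_scale L (t ^ j / fact j) ((X ^^ (i + j)) v))" if "finite A" for A
      using that by (induction A rule: finite_induct)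
        (simp_all add: End_pow_0 X End_pow_add mem_sum mem_scale End_pow_mem v End_pow_scale
          funpow_add)
    show ?thesis using v * by (simp add: nilexp_def)
  qed
  then have "nilexp L N X s (nilexp L N X t v) = (\<Sum>i<N. \<Sum>j<N. ?g i j)"
    using v nilexp_mem[OF v] by (simp add: nilexp_def[of L N X s] V.scale_sum_right)
  also have "\<dots> = (\<Sum>k<2*N. \<Sum>i\<le>k. ?g i (k - i))"
    by (rule sum_Cauchy_product_truncated[symmetric]) (auto simp: nil_ge[OF v])
  also have "\<dots> = (\<Sum>k<2*N. lie_scale L ((s + t) ^ k / fact k) ((X ^^ k) v))"
  proof (rule sum.cong[OF refl])
    fix k
    have "(s + t) ^ k / fact k = (\<Sum>i\<le>k. s ^ i / fact i * (t ^ (k - i) / fact (k - i)))"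
      by (simp add: binomial_ring sum_divide_distrib binomial_fact field_simps)
    then show "(\<Sum>i\<le>k. ?g i (k - i)) = lie_scale L ((s + t) ^ k / fact k) ((X ^^ k) v)"
      by (simp add: V.scale_sum_left)
  qed
  also have "\<dots> = (\<Sum>k<N. lie_scale L ((s + t) ^ k / fact k) ((X ^^ k) v))"
    by (rule sum.mono_neutral_right) (auto simp: nil_ge[OF v])
  finally show ?thesis using v by (simp add: nilexp_def)
qed

lemma nilexp_GL: "nilexp L N X t \<in> lie_GL L"
proof -
  have "nilexp L N X t (nilexp L N X (- t) v) = v" "nilexp L N X (- t) (nilexp L N X t v) = v"
    if "v \<in> lie_space L" for v
    using that by (simp_all add: nilexp_add nilexp_0)
  then have "bij_betw (nilexp L N X t) (lie_space L) (lie_space L)"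
    by (intro bij_betwI[where g = "nilexp L N X (- t)"]) (auto simp: nilexp_mem)
  then show ?thesis
    using nilexp_End[of t] by (auto simp: lie_GL_def Bij_def nilexp_def)
qed

text \<open>
  The exponential of a nilpotent derivation is an automorphism: the divided powers \<open>d w k\<close>,
  which are \<open>t\<^sup>k X\<^sup>k w / k!\<close>, satisfy a Leibniz rule without binomial coefficients, and the sum over
  \<open>k\<close> turns it into multiplicativity.
\<close>

lemma nilexp_br:
  assumes der: "\<And>u v. u \<in> lie_space L \<Longrightarrow> v \<in> lie_space L \<Longrightarrow>
      X (lie_br L u v) = lie_br L (X u) v + lie_br L u (X v)"
    and u: "u \<in> lie_space L" and v: "v \<in> lie_space L"
  shows "nilexp L N X t (lie_br L u v) = lie_br L (nilexp L N X t u) (nilexp L N X t v)"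
proof -
  define d where "d w k = lie_scale L (t ^ k / fact k) ((X ^^ k) w)" for w k
  have d_mem: "d w k \<in> lie_space L" if "w \<in> lie_space L" for w k
    unfolding d_def using that by (intro mem_scale End_pow_mem X)
  have d_Suc: "lie_scale L t (X (d w k)) = lie_scale L (of_nat (Suc k)) (d w (Suc k))"
    if "w \<in> lie_space L" for w k
    using that unfolding d_def
    by (simp add: End_scale[OF X] End_pow_mem[OF X] field_simps del: of_nat_Suc)
  have Leibniz: "d (lie_br L u v) k = (\<Sum>i\<le>k. lie_br L (d u i) (d v (k - i)))" for k
  proof (induction k)
    case 0
    then show ?case by (simp add: d_def)
  next
    case (Suc k)
    let ?b = "\<lambda>i. lie_br L (d u i) (d v (Suc k - i))"
    \<comment> \<open>Multiplied by \<open>k + 1\<close>, the claim splits according to \<open>k + 1 = i + (k + 1 - i)\<close>.\<close>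
    have "lie_scale L (of_nat (Suc k)) (d (lie_br L u v) (Suc k))
        = lie_scale L t (X (\<Sum>i\<le>k. lie_br L (d u i) (d v (k - i))))"
      using Suc d_Suc[of "lie_br L u v" k] by (simp add: br_closed u v)
    also have "\<dots> = (\<Sum>i\<le>k. lie_br L (lie_scale L t (X (d u i))) (d v (k - i))
        + lie_br L (d u i) (lie_scale L t (X (d v (k - i)))))"
      by (simp add: End_sum[OF X] der d_mem u v br_closed V.scale_sum_right V.scale_right_distrib
          br_scale_left br_scale_right End_mem[OF X])
    also have "\<dots> = (\<Sum>i\<le>k. lie_scale L (of_nat (Suc i)) (?b (Suc i)))
        + (\<Sum>i\<le>k. lie_scale L (of_nat (Suc k - i)) (?b i))"
      by (simp add: d_Suc u v br_scale_left br_scale_right d_mem sum.distrib Suc_diff_le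
          del: of_nat_Suc)
    also have "(\<Sum>i\<le>k. lie_scale L (of_nat (Suc i)) (?b (Suc i)))
        = (\<Sum>i\<le>Suc k. lie_scale L (of_nat i) (?b i))"
      by (subst sum.atMost_Suc_shift) simp
    also have "(\<Sum>i\<le>k. lie_scale L (of_nat (Suc k - i)) (?b i))
        = (\<Sum>i\<le>Suc k. lie_scale L (of_nat (Suc k - i)) (?b i))"
      by simp
    also have "(\<Sum>i\<le>Suc k. lie_scale L (of_nat i) (?b i))
        + (\<Sum>i\<le>Suc k. lie_scale L (of_nat (Suc k - i)) (?b i))
        = (\<Sum>i\<le>Suc k. lie_scale L (of_nat (Suc k)) (?b i))"
      unfolding sum.distrib[symmetric]
      by (rule sum.cong[OF refl]) (simp add: V.scale_left_distrib[symmetric] of_nat_add[symmetric] del: of_nat_add of_nat_Suc)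
    finally have "lie_scale L (of_nat (Suc k)) (d (lie_br L u v) (Suc k))
        = lie_scale L (of_nat (Suc k)) (\<Sum>i\<le>Suc k. ?b i)"
      by (simp only: V.scale_sum_right)
    then show ?case by (simp only: V.scale_cancel_left of_nat_eq_0_iff) simp
  qed
  have d_nil: "d w k = 0" if "w \<in> lie_space L" "N \<le> k" for w k
    using that by (simp add: d_def nil_ge)
  have "nilexp L N X t (lie_br L u v) = (\<Sum>k<N. d (lie_br L u v) k)"
    using u v by (simp add: nilexp_def d_def br_closed)
  also have "\<dots> = (\<Sum>k<2*N. d (lie_br L u v) k)"
    by (rule sum.mono_neutral_left) (auto simp: d_nil br_closed u v)
  also have "\<dots> = (\<Sum>i<N. \<Sum>j<N. lie_br L (d u i) (d v j))"
    unfolding Leibniz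
    by (rule sum_Cauchy_product_truncated) (auto simp: d_nil u v br_0_left br_0_right d_mem)
  also have "\<dots> = lie_br L (\<Sum>i<N. d u i) (\<Sum>j<N. d v j)"
    by (subst br_sum_left) (auto simp: br_sum_right d_mem u v mem_sum)
  finally show ?thesis
    using u v by (simp add: nilexp_def d_def)
qed

end

section \<open>Exponentials in algebraic groups\<close>

text \<open>
  The only point is that \<open>\<phi> \<circ> g\<close> is linear on the Lie algebra alone, while the coordinate functions use
  linear forms on the whole type; a basis of the Lie algebra provides an extension.
\<close>

lemma (in fd_lie_algebra) poly_funs_left_translate:
  assumes g: "g \<in> lie_End L" and P: "P \<in> poly_funs L"
  shows "\<exists>P'\<in>poly_funs L. \<forall>f\<in>lie_End L. P' f = P (compose (lie_space L) g f)"
  using P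
proof induction
  case (const c)
  then show ?case by (auto intro: poly_funs.const)
next
  case (coord v \<phi>)
  interpret \<phi>: Vector_Spaces.linear "lie_scale L" "(*)" \<phi> by fact
  interpret VP: vector_space_pair "lie_scale L" "(*) :: complex \<Rightarrow> complex \<Rightarrow> complex" ..
  obtain B where B: "B \<subseteq> lie_space L" "V.independent B" "lie_space L \<subseteq> V.span B"
    using V.maximal_independent_subset[of "lie_space L"] by blast
  obtain \<psi> where \<psi>: "Vector_Spaces.linear (lie_scale L) (*) \<psi>" "\<And>b. b \<in> B \<Longrightarrow> \<psi> b = \<phi> (g b)"
    using VP.linear_independent_extend[OF B(2), of "\<phi> \<circ> g"] by auto
  interpret \<psi>: Vector_Spaces.linear "lie_scale L" "(*)" \<psi> by fact
  have "w \<in> lie_space L \<and> \<psi> w = \<phi> (g w)" if "w \<in> V.span B" for w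
    using that
  proof (induction rule: V.span_induct_alt)
    case base
    then show ?case by (simp add: zero_mem \<psi>.zero \<phi>.zero End_0[OF g])
  next
    case (step c b w)
    then have "b \<in> lie_space L" using B by auto
    with step show ?case
      by (simp add: mem_add mem_scale End_add[OF g] End_scale[OF g] \<phi>.add \<psi>.add \<phi>.scale \<psi>.scale \<psi>(2))
  qed
  then have eq: "\<psi> w = \<phi> (g w)" if "w \<in> lie_space L" for w
    using that B(3) by blast
  show ?case
    by (rule bexI[OF _ poly_funs.coord[OF coord(1) \<psi>(1)]])
      (use coord in \<open>auto simp: compose_def eq End_mem\<close>)
next
  case (add P Q)
  then obtain P' Q' where "P' \<in> poly_funs L" "Q' \<in> poly_funs L"
    "\<forall>f\<in>lie_End L. P' f = P (compose (lie_space L) g f)"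
    "\<forall>f\<in>lie_End L. Q' f = Q (compose (lie_space L) g f)" by blast
  then show ?case
    by (intro bexI[of _ "\<lambda>f. P' f + Q' f"]) (auto intro: poly_funs.add)
next
  case (mult P Q)
  then obtain P' Q' where "P' \<in> poly_funs L" "Q' \<in> poly_funs L"
    "\<forall>f\<in>lie_End L. P' f = P (compose (lie_space L) g f)"
    "\<forall>f\<in>lie_End L. Q' f = Q (compose (lie_space L) g f)" by blast
  then show ?case
    by (intro bexI[of _ "\<lambda>f. P' f * Q' f"]) (auto intro: poly_funs.mult)
qed

context nilpotent_endomorphism
begin

text \<open>
  \<open>Q\<close> is the image of \<open>P\<close> under the left invariant vector field of \<open>X\<close>.  Since \<open>t \<mapsto> exp (t X)\<close> is an
  integral curve of this field, \<open>Q\<close> restricts on it to the derivative of the restriction of \<open>P\<close>.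
\<close>

lemma poly_funs_derivative:
  assumes P: "P \<in> poly_funs L"
  shows "\<exists>Q\<in>poly_funs L. \<exists>p.
      (\<forall>t. P (nilexp L N X t) = poly p t) \<and> (\<forall>t. Q (nilexp L N X t) = poly (pderiv p) t) \<and>
      (\<forall>f\<in>lie_End L. ((\<lambda>t. P (compose (lie_space L) f (\<lambda>v\<in>lie_space L. v + lie_scale L t (X v))))
          has_field_derivative Q f) (at 0))"
    (is "\<exists>Q\<in>_. \<exists>p. _ \<and> _ \<and> (\<forall>f\<in>_. ((\<lambda>t. P (?c f t)) has_field_derivative _) _)")
  using P
proof induction
  case (const c)
  show ?case
    by (rule bexI[OF _ poly_funs.const[of 0]], rule exI[of _ "[:c:]"]) auto
next
  case (coord v \<phi>)
  interpret \<phi>: Vector_Spaces.linear "lie_scale L" "(*)" \<phi> by fact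
  let ?a = "\<lambda>k. \<phi> ((X ^^ k) v) / fact k"
  define p where "p = (\<Sum>k<N. monom (?a k) k)"
  have ev: "\<phi> (nilexp L N X t w) = (\<Sum>k<N. \<phi> ((X ^^ k) w) / fact k * t ^ k)" if "w \<in> lie_space L" for t w
    using that by (simp add: nilexp_def \<phi>.sum \<phi>.scale field_simps)
  have "coeff p k = ?a k" for k
    using nil_ge[OF coord(1)] by (auto simp: p_def coeff_sum \<phi>.zero)
  then have "coeff (pderiv p) k = \<phi> ((X ^^ k) (X v)) / fact k" for k
  proof -
    assume "\<And>k. coeff p k = ?a k"
    then have "coeff (pderiv p) k = of_nat (Suc k) * ?a (Suc k)"
      by (simp only: coeff_pderiv)
    also have "\<dots> = \<phi> ((X ^^ Suc k) v) / fact k"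
      by (simp only: fact_Suc of_nat_mult) (simp add: field_simps del: of_nat_Suc funpow.simps)
    finally show ?thesis
      by (simp only: funpow_Suc_right o_apply)
  qed
  then have "pderiv p = (\<Sum>k<N. monom (\<phi> ((X ^^ k) (X v)) / fact k) k)"
    using nil_ge[OF End_mem[OF X coord(1)]] by (auto simp: poly_eq_iff coeff_sum \<phi>.zero)
  then have 2: "\<phi> (nilexp L N X t (X v)) = poly (pderiv p) t" for t
    by (simp add: ev End_mem[OF X coord(1)] poly_sum poly_monom)
  have 1: "\<phi> (nilexp L N X t v) = poly p t" for t
    by (simp add: ev coord(1) p_def poly_sum poly_monom)
  have 3: "((\<lambda>t. \<phi> (compose (lie_space L) f (\<lambda>v\<in>lie_space L. v + lie_scale L t (X v)) v))
      has_field_derivative \<phi> (f (X v))) (at 0)" if f: "f \<in> lie_End L" for f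
  proof -
    have "\<phi> (compose (lie_space L) f (\<lambda>v\<in>lie_space L. v + lie_scale L t (X v)) v)
        = \<phi> (f v) + t * \<phi> (f (X v))" for t
      using f coord(1) X
      by (simp add: compose_def End_add End_scale End_mem mem_scale \<phi>.add \<phi>.scale)
    then show ?thesis
      by (auto intro!: derivative_eq_intros)
  qed
  show ?case
    by (rule bexI[OF _ poly_funs.coord[OF End_mem[OF X coord(1)] coord(2)]], rule exI[of _ p])
      (use 1 2 3 in blast)
next
  case (add P Q)
  from add.IH(1) obtain P' p where P: "P' \<in> poly_funs L"
    "\<And>t. P (nilexp L N X t) = poly p t" "\<And>t. P' (nilexp L N X t) = poly (pderiv p) t"
    "\<And>f. f \<in> lie_End L \<Longrightarrow> ((\<lambda>t. P (?c f t)) has_field_derivative P' f) (at 0)"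
    by (elim bexE exE conjE) blast
  from add.IH(2) obtain Q' q where Q: "Q' \<in> poly_funs L"
    "\<And>t. Q (nilexp L N X t) = poly q t" "\<And>t. Q' (nilexp L N X t) = poly (pderiv q) t"
    "\<And>f. f \<in> lie_End L \<Longrightarrow> ((\<lambda>t. Q (?c f t)) has_field_derivative Q' f) (at 0)"
    by (elim bexE exE conjE) blast
  show ?case
  proof (intro bexI[of _ "\<lambda>f. P' f + Q' f"] exI[of _ "p + q"] conjI allI ballI)
    show "((\<lambda>t. P (?c f t) + Q (?c f t)) has_field_derivative P' f + Q' f) (at 0)"
      if "f \<in> lie_End L" for f
      by (rule DERIV_add[OF P(4)[OF that] Q(4)[OF that]])
  qed (use P(1-3) Q(1-3) in \<open>simp_all add: pderiv_add poly_funs.add\<close>)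
next
  case (mult P Q)
  from mult.IH(1) obtain P' p where P: "P' \<in> poly_funs L"
    "\<And>t. P (nilexp L N X t) = poly p t" "\<And>t. P' (nilexp L N X t) = poly (pderiv p) t"
    "\<And>f. f \<in> lie_End L \<Longrightarrow> ((\<lambda>t. P (?c f t)) has_field_derivative P' f) (at 0)"
    by (elim bexE exE conjE) blast
  from mult.IH(2) obtain Q' q where Q: "Q' \<in> poly_funs L"
    "\<And>t. Q (nilexp L N X t) = poly q t" "\<And>t. Q' (nilexp L N X t) = poly (pderiv q) t"
    "\<And>f. f \<in> lie_End L \<Longrightarrow> ((\<lambda>t. Q (?c f t)) has_field_derivative Q' f) (at 0)"
    by (elim bexE exE conjE) blast
  show ?case
  proof (intro bexI[of _ "\<lambda>f. P' f * Q f + Q' f * P f"] exI[of _ "p * q"] conjI allI ballI)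
    show "((\<lambda>t. P (?c f t) * Q (?c f t)) has_field_derivative P' f * Q f + Q' f * P f) (at 0)"
      if f: "f \<in> lie_End L" for f
    proof -
      have "?c f 0 = f"
        using f by (auto simp: compose_def lie_End_def PiE_def extensional_def)
      then show ?thesis
        using DERIV_mult[OF P(4)[OF f] Q(4)[OF f]] by (simp only:)
    qed
    show "(\<lambda>f. P' f * Q f + Q' f * P f) \<in> poly_funs L"
      using P(1) Q(1) mult.hyps by (intro poly_funs.add poly_funs.mult)
  qed (use P(2,3) Q(2,3) in \<open>simp_all add: pderiv_mult algebra_simps\<close>)
qed

text \<open>
  The ideal of \<open>G\<close> is closed under the derivation of the previous lemma, by left translation.  So the
  polynomials \<open>p\<close> that arise by restricting the ideal to the curve \<open>exp (t X)\<close> are closed under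
  derivatives and vanish at \<open>0\<close>; induction on the degree shows that there is only the zero one.
\<close>

theorem nilexp_in_algebraic_subgroup:
  assumes G: "algebraic_subgroup L G" and XG: "X \<in> group_lie_algebra L G"
  shows "nilexp L N X t \<in> G"
proof -
  interpret G: subgroup G "BijGroup (lie_space L)"
    using G by (simp add: algebraic_subgroup_def)
  have GGL: "G \<subseteq> lie_GL L"
    using G by (simp add: algebraic_subgroup_def)
  have mult: "compose (lie_space L) f g \<in> G" if "f \<in> G" "g \<in> G" for f g
  proof -
    have "f \<in> Bij (lie_space L)" "g \<in> Bij (lie_space L)"
      using that GGL unfolding lie_GL_def by blast+
    then show ?thesis
      using G.m_closed[OF that] by (simp add: BijGroup_def)
  qed
  have one: "nilexp L N X 0 \<in> G"
  proof -
    have "nilexp L N X 0 = (\<lambda>v\<in>lie_space L. v)"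
      using nilexp_0 by (auto simp: nilexp_def)
    then show ?thesis using G.one_closed by (simp add: BijGroup_def)
  qed
  have vanish: "p = 0"
    if "P \<in> poly_funs L" "\<And>f. f \<in> G \<Longrightarrow> P f = 0" "\<And>t. P (nilexp L N X t) = poly p t" for P p
    using that
  proof (induction "degree p" arbitrary: P p rule: less_induct)
    case less
    obtain Q p' where Q: "Q \<in> poly_funs L" "\<And>t. P (nilexp L N X t) = poly p' t"
      "\<And>t. Q (nilexp L N X t) = poly (pderiv p') t"
      "\<And>f. f \<in> lie_End L \<Longrightarrow>
        ((\<lambda>t. P (compose (lie_space L) f (\<lambda>v\<in>lie_space L. v + lie_scale L t (X v))))
          has_field_derivative Q f) (at 0)"
      using poly_funs_derivative[OF less.prems(1)] by blast
    have "p' = p"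
      using Q(2) less.prems(3) by (metis poly_eq_poly_eq_iff ext)
    \<comment> \<open>\<open>P'\<close> is the left translate of \<open>P\<close> by \<open>f\<close>; it lies in the ideal of \<open>G\<close> with \<open>P\<close>.\<close>
    have QG: "Q f = 0" if f: "f \<in> G" for f
    proof -
      have fE: "f \<in> lie_End L" using f GGL unfolding lie_GL_def by blast
      obtain P' where P': "P' \<in> poly_funs L"
        "\<And>g. g \<in> lie_End L \<Longrightarrow> P' g = P (compose (lie_space L) f g)"
        using poly_funs_left_translate[OF fE less.prems(1)] by blast
      have "P' g = 0" if "g \<in> G" for g
        using P'(2)[of g] less.prems(2)[OF mult[OF f that]] that GGL unfolding lie_GL_def
        by (metis IntD1 subsetD)
      then have "((\<lambda>t. P' (\<lambda>v\<in>lie_space L. v + lie_scale L t (X v))) has_field_derivative 0) (at 0)"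
        using XG P'(1) unfolding group_lie_algebra_def by blast
      then have "((\<lambda>t. P (compose (lie_space L) f (\<lambda>v\<in>lie_space L. v + lie_scale L t (X v))))
          has_field_derivative 0) (at 0)"
        by (simp only: P'(2)[OF one_plus_End[OF X]])
      then show ?thesis
        using Q(4)[OF fE] DERIV_unique by blast
    qed
    have "degree p = 0"
    proof (rule ccontr)
      assume "degree p \<noteq> 0"
      then have "degree (pderiv p) < degree p"
        by (simp add: degree_pderiv)
      then have "pderiv p = 0"
        using less.hyps[OF _ Q(1) QG] Q(3) \<open>p' = p\<close> by blast
      then show False using \<open>degree p \<noteq> 0\<close> by (simp add: pderiv_eq_0_iff)
    qed
    then obtain c where "p = [:c:]" by (rule degree_eq_zeroE)
    then show ?case
      using less.prems(2)[OF one] less.prems(3)[of 0] by simp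
  qed
  obtain Ps where Ps: "Ps \<subseteq> poly_funs L" "G = {f \<in> lie_GL L. \<forall>P\<in>Ps. P f = 0}"
    using G by (auto simp: algebraic_subgroup_def)
  have "P (nilexp L N X t) = 0" if PPs: "P \<in> Ps" for P
  proof -
    have P: "P \<in> poly_funs L" using Ps(1) PPs by blast
    obtain p where p: "\<And>t. P (nilexp L N X t) = poly p t"
      using poly_funs_derivative[OF P] by (elim bexE exE conjE) blast
    have PG: "P f = 0" if "f \<in> G" for f
      using that PPs unfolding Ps(2) by blast
    have "p = 0"
      by (rule vanish[OF P PG p])
    then show ?thesis by (simp add: p)
  qed
  then show ?thesis
    using Ps(2) nilexp_GL by blast
qed

end

section \<open>Lie algebra automorphisms\<close>

definition lie_aut :: "'a::ab_group_add lie_alg \<Rightarrow> ('a \<Rightarrow> 'a) set" where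
  "lie_aut L = {a \<in> lie_GL L. \<forall>u\<in>lie_space L. \<forall>v\<in>lie_space L.
     a (lie_br L u v) = lie_br L (a u) (a v)}"

context fd_lie_algebra
begin

lemma aut_End: "a \<in> lie_aut L \<Longrightarrow> a \<in> lie_End L"
  by (simp add: lie_aut_def lie_GL_def)

lemma aut_bij: "a \<in> lie_aut L \<Longrightarrow> bij_betw a (lie_space L) (lie_space L)"
  by (simp add: lie_aut_def lie_GL_def Bij_def)

lemma aut_mem: "a \<in> lie_aut L \<Longrightarrow> v \<in> lie_space L \<Longrightarrow> a v \<in> lie_space L"
  by (simp add: aut_End End_mem)

lemma aut_br:
  "a \<in> lie_aut L \<Longrightarrow> u \<in> lie_space L \<Longrightarrow> v \<in> lie_space L \<Longrightarrow> a (lie_br L u v) = lie_br L (a u) (a v)"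
  by (simp add: lie_aut_def)

lemma lie_autI:
  assumes "a \<in> lie_End L" "bij_betw a (lie_space L) (lie_space L)"
    and "\<And>u v. u \<in> lie_space L \<Longrightarrow> v \<in> lie_space L \<Longrightarrow> a (lie_br L u v) = lie_br L (a u) (a v)"
  shows "a \<in> lie_aut L"
proof -
  have "a \<in> extensional (lie_space L)"
    using assms(1) by (simp add: lie_End_def PiE_def)
  with assms show ?thesis
    unfolding lie_aut_def lie_GL_def Bij_def by blast
qed

lemma aut_compose:
  assumes a: "a \<in> lie_aut L" and b: "b \<in> lie_aut L"
  shows "compose (lie_space L) a b \<in> lie_aut L"
proof (rule lie_autI)
  show "bij_betw (compose (lie_space L) a b) (lie_space L) (lie_space L)"
    using aut_bij[OF b] aut_bij[OF a] by (rule bij_betw_compose)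
  show "compose (lie_space L) a b \<in> lie_End L"
    by (intro End_compose aut_End a b)
qed (simp add: compose_def br_closed aut_br[OF a] aut_br[OF b] aut_mem[OF b])

lemma aut_one: "(\<lambda>v\<in>lie_space L. v) \<in> lie_aut L"
  by (rule lie_autI) (auto simp: lie_End_def mem_add mem_scale br_closed bij_betw_def inj_on_def)

text \<open>
  As \<open>a\<close> is linear only on the Lie algebra, it is replaced by a linear map \<open>g\<close> of the whole type that
  agrees with it on \<open>A\<close>.
\<close>

lemma dim_image_End:
  assumes a: "a \<in> lie_End L" "inj_on a (lie_space L)"
    and A: "lie_subspace L A" "A \<subseteq> lie_space L"
  shows "lie_dim L (a ` A) = lie_dim L A"
proof -
  interpret VV: vector_space_pair "lie_scale L" "lie_scale L" ..
  obtain B where B: "B \<subseteq> A" "V.independent B" "A \<subseteq> V.span B" "card B = lie_dim L A"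
    using V.basis_exists[of A] by blast
  have span: "V.span B = A"
    using B(1,3) A(1) by (intro V.span_subspace)
  obtain g where g: "Vector_Spaces.linear (lie_scale L) (lie_scale L) g" "\<And>b. b \<in> B \<Longrightarrow> g b = a b"
    using VV.linear_independent_extend[OF B(2), of a] by blast
  interpret g: Vector_Spaces.linear "lie_scale L" "lie_scale L" g by fact
  have "w \<in> A \<and> g w = a w" if "w \<in> V.span B" for w
    using that
  proof (induction rule: V.span_induct_alt)
    case base
    then show ?case using V.subspace_0[OF A(1)] by (simp add: g.zero End_0[OF a(1)])
  next
    case (step c b w)
    then have "b \<in> A" using B by auto
    with step A show ?case
      by (auto simp: V.subspace_add V.subspace_scale End_add[OF a(1)] End_scale[OF a(1)] mem_scale
          subset_iff g.add g.scale g(2))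
  qed
  then have eq: "g w = a w" if "w \<in> A" for w
    using that span by blast
  have inj: "inj_on g A"
    using inj_on_subset[OF a(2) A(2)] eq by (auto simp: inj_on_def)
  have "lie_dim L (g ` A) = card (g ` B)"
  proof (rule V.dim_unique)
    show "V.independent (g ` B)"
      using inj B(2) by (intro g.independent_injective_image) (simp_all add: span)
    show "g ` A \<subseteq> V.span (g ` B)"
      by (simp add: g.span_image span)
  qed (use B in auto)
  also have "\<dots> = card B"
    by (rule card_image[OF inj_on_subset[OF inj B(1)]])
  finally show ?thesis
    using B(4) eq by (simp cong: image_cong)
qed

lemma subspace_centralizer: "z \<in> lie_space L \<Longrightarrow> lie_subspace L (lie_centralizer L z)"
  by (auto simp: V.subspace_def lie_centralizer_def zero_mem br_0_right mem_add mem_scale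
      br_add_right br_scale_right)

lemma aut_image_centralizer:
  assumes a: "a \<in> lie_aut L" and z: "z \<in> lie_space L"
  shows "a ` lie_centralizer L z = lie_centralizer L (a z)"
proof -
  have inj: "inj_on a (lie_space L)" and surj: "a ` lie_space L = lie_space L"
    using aut_bij[OF a] by (simp_all add: bij_betw_def)
  have iff: "lie_br L (a z) (a v) = 0 \<longleftrightarrow> lie_br L z v = 0" if "v \<in> lie_space L" for v
    using inj_onD[OF inj, of "lie_br L z v" 0] that z
    by (auto simp: aut_br[OF a, symmetric] zero_mem br_closed End_0[OF aut_End[OF a]])
  show ?thesis
  proof
    show "a ` lie_centralizer L z \<subseteq> lie_centralizer L (a z)"
      by (auto simp: lie_centralizer_def aut_mem[OF a] iff)
    show "lie_centralizer L (a z) \<subseteq> a ` lie_centralizer L z"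
    proof
      fix w assume w: "w \<in> lie_centralizer L (a z)"
      then obtain v where "v \<in> lie_space L" "w = a v"
        using surj by (auto simp: lie_centralizer_def)
      with w iff show "w \<in> a ` lie_centralizer L z"
        by (auto simp: lie_centralizer_def)
    qed
  qed
qed

lemma aut_dim_centralizer:
  assumes a: "a \<in> lie_aut L" and z: "z \<in> lie_space L"
  shows "lie_dim L (lie_centralizer L (a z)) = lie_dim L (lie_centralizer L z)"
  unfolding aut_image_centralizer[OF a z, symmetric]
proof (rule dim_image_End[OF aut_End[OF a] _ subspace_centralizer[OF z]])
  show "inj_on a (lie_space L)"
    using aut_bij[OF a] by (simp add: bij_betw_def)
qed (auto simp: lie_centralizer_def)

lemma adjoint_group_compose:
  assumes a: "a \<in> algebraic_adjoint_group L" "a \<in> lie_aut L"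
    and b: "b \<in> algebraic_adjoint_group L" "b \<in> lie_aut L"
  shows "compose (lie_space L) a b \<in> algebraic_adjoint_group L"
  unfolding algebraic_adjoint_group_def
proof (rule InterI)
  fix G assume "G \<in> {G. algebraic_subgroup L G \<and> lie_ad L ` lie_space L \<subseteq> group_lie_algebra L G}"
  with a(1) b(1) have "a \<in> G" "b \<in> G" "subgroup G (BijGroup (lie_space L))"
    by (auto simp: algebraic_adjoint_group_def algebraic_subgroup_def)
  then have "a \<otimes>\<^bsub>BijGroup (lie_space L)\<^esub> b \<in> G"
    by (simp add: subgroup.m_closed)
  moreover have "a \<in> Bij (lie_space L)" "b \<in> Bij (lie_space L)"
    using a(2) b(2) by (simp_all add: lie_aut_def lie_GL_def)
  ultimately show "compose (lie_space L) a b \<in> G"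
    by (simp add: BijGroup_def)
qed

lemma adjoint_group_one: "(\<lambda>v\<in>lie_space L. v) \<in> algebraic_adjoint_group L"
  by (auto simp: algebraic_adjoint_group_def algebraic_subgroup_def BijGroup_def
      dest: subgroup.one_closed)

end

lemma (in nilpotent_endomorphism) nilexp_ad:
  assumes z: "z \<in> lie_space L" and Xz: "X = lie_ad L z"
  shows "nilexp L N X t \<in> algebraic_adjoint_group L" and "nilexp L N X t \<in> lie_aut L"
proof -
  show "nilexp L N X t \<in> algebraic_adjoint_group L"
    unfolding algebraic_adjoint_group_def
    using nilexp_in_algebraic_subgroup z Xz by blast
  have der: "X (lie_br L u v) = lie_br L (X u) v + lie_br L u (X v)"
    if "u \<in> lie_space L" "v \<in> lie_space L" for u v
    using that z by (simp add: Xz lie_ad_def br_closed br_derivation[OF z that])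
  show "nilexp L N X t \<in> lie_aut L"
    unfolding lie_aut_def using nilexp_GL nilexp_br[OF der] by blast
qed


section \<open>Takiff algebras are Lie algebras\<close>

lemma takiff_mem_iff:
  "p \<in> lie_space (takiff L n) \<longleftrightarrow> (\<forall>k. coeff p k \<in> lie_space L) \<and> (\<forall>k>n. coeff p k = 0)"
  by (auto simp: takiff_def current_def coeff_eq_0 intro: degree_le)

lemma jet_eq_iff: "jet m p = jet m q \<longleftrightarrow> (\<forall>k\<le>m. coeff p k = coeff q k)"
  by (auto simp: poly_eq_iff coeff_jet)

lemma jet_takiff: "p \<in> lie_space (takiff L n) \<Longrightarrow> jet n p = p"
  by (auto simp: poly_eq_iff coeff_jet takiff_mem_iff)

lemma jet_jet: "m \<le> n \<Longrightarrow> jet m (jet n p) = jet m p"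
  by (auto simp: poly_eq_iff coeff_jet)

text \<open>The symmetry of \<open>{(i, j, l). i + j + l = k}\<close> under rotation, for the Jacobi identity.\<close>

lemma sum_cyclic:
  fixes g :: "nat \<Rightarrow> nat \<Rightarrow> nat \<Rightarrow> 'b::comm_monoid_add"
  shows "(\<Sum>i\<le>k. \<Sum>j\<le>k - i. g i j (k - i - j)) = (\<Sum>i\<le>k. \<Sum>j\<le>k - i. g j (k - i - j) i)"
proof -
  have "(\<Sum>(i, j)\<in>(SIGMA i:{..k}. {..k - i}). g i j (k - i - j))
      = (\<Sum>(i, j)\<in>(SIGMA i:{..k}. {..k - i}). g j (k - i - j) i)"
    by (rule sum.reindex_bij_witness[where i = "\<lambda>(i, j). (j, k - i - j)"
          and j = "\<lambda>(i, j). (k - i - j, i)"]) auto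
  then show ?thesis
    by (simp only: sum.Sigma[OF finite_atMost ballI[OF finite_atMost]])
qed

context fd_lie_algebra
begin

lemma coeff_takiff_scale: "coeff (lie_scale (takiff L n) c p) k = lie_scale L c (coeff p k)"
  by (simp add: takiff_def coeff_current_scale)

lemma coeff_takiff_br:
  assumes "p \<in> lie_space (takiff L n)" "q \<in> lie_space (takiff L n)"
  shows "coeff (lie_br (takiff L n) p q) k
    = (if k \<le> n then \<Sum>i\<le>k. lie_br L (coeff p i) (coeff q (k - i)) else 0)"
  using assms by (simp add: takiff_def coeff_jet coeff_current_br)

lemma takiff_br_mem:
  assumes "p \<in> lie_space (takiff L n)" "q \<in> lie_space (takiff L n)"
  shows "lie_br (takiff L n) p q \<in> lie_space (takiff L n)"
proof -
  have "coeff p k \<in> lie_space L" "coeff q k \<in> lie_space L" for k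
    using assms by (simp_all add: takiff_mem_iff)
  then have "(\<Sum>i\<le>k. lie_br L (coeff p i) (coeff q (k - i))) \<in> lie_space L" for k
    by (intro mem_sum br_closed)
  then show ?thesis
    unfolding takiff_mem_iff[of "lie_br _ _ _"] coeff_takiff_br[OF assms] by (simp add: zero_mem)
qed

lemma vector_space_takiff: "vector_space (lie_scale (takiff L n))"
  by unfold_locales
    (simp_all add: poly_eq_iff coeff_takiff_scale V.scale_right_distrib V.scale_left_distrib)

lemma takiff_finite_dim: "\<exists>B. finite B \<and> lie_span (takiff L n) B = lie_space (takiff L n)"
proof -
  interpret TV: vector_space "lie_scale (takiff L n)" by (rule vector_space_takiff)
  obtain B where B: "finite B" "V.span B = lie_space L"
    using finite_dim by blast
  let ?B = "(\<lambda>(b, k). monom b k) ` (B \<times> {..n})"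
  have "TV.subspace (lie_space (takiff L n))"
    by (auto simp: TV.subspace_def takiff_mem_iff coeff_takiff_scale zero_mem mem_add mem_scale)
  moreover have "?B \<subseteq> lie_space (takiff L n)"
    using B(2) V.span_superset[of B] by (auto simp: takiff_mem_iff zero_mem)
  ultimately have 1: "TV.span ?B \<subseteq> lie_space (takiff L n)"
    by (intro TV.span_minimal)
  have mon: "monom b k \<in> TV.span ?B" if "b \<in> V.span B" "k \<le> n" for b k
    using that(1)
  proof (induction rule: V.span_induct_alt)
    case base
    then show ?case by (simp add: TV.span_zero)
  next
    case (step c b w)
    have "monom (lie_scale L c b + w) k = lie_scale (takiff L n) c (monom b k) + monom w k"
      by (simp add: poly_eq_iff coeff_takiff_scale)
    moreover have "monom b k \<in> TV.span ?B"
      using step(1) that(2) by (intro TV.span_base) auto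
    ultimately show ?case
      using step(2) by (simp add: TV.span_add TV.span_scale)
  qed
  have "p \<in> TV.span ?B" if p: "p \<in> lie_space (takiff L n)" for p
  proof -
    have "p = (\<Sum>k\<le>n. monom (coeff p k) k)"
      using p by (auto simp: poly_eq_iff coeff_sum takiff_mem_iff)
    also have "\<dots> \<in> TV.span ?B"
      using p B(2) by (intro TV.span_sum mon) (auto simp: takiff_mem_iff)
    finally show ?thesis .
  qed
  with 1 B(1) show ?thesis
    by (intro exI[of _ ?B]) auto
qed

theorem fd_lie_algebra_takiff: "fd_lie_algebra (takiff L n)"
proof (rule fd_lie_algebra.intro)
  interpret TV: vector_space "lie_scale (takiff L n)" by (rule vector_space_takiff)
  let ?T = "lie_space (takiff L n)"
  have mem: "coeff p k \<in> lie_space L" if "p \<in> ?T" for p k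
    using that by (simp add: takiff_mem_iff)
  have add_mem: "p + q \<in> ?T" if "p \<in> ?T" "q \<in> ?T" for p q
    using that by (simp add: takiff_mem_iff mem_add)
  have scale_mem: "lie_scale (takiff L n) c p \<in> ?T" if "p \<in> ?T" for c p
    using that by (simp add: takiff_mem_iff coeff_takiff_scale mem_scale)
  show "vector_space (lie_scale (takiff L n))"
    by (rule vector_space_takiff)
  show "lie_subspace (takiff L n) ?T"
    by (auto simp: TV.subspace_def add_mem scale_mem) (simp add: takiff_mem_iff zero_mem)
  show "\<exists>B. finite B \<and> lie_span (takiff L n) B = ?T"
    by (rule takiff_finite_dim)
  fix x y z assume x: "x \<in> ?T" and y: "y \<in> ?T"
  show "lie_br (takiff L n) x y \<in> ?T"
    using x y by (rule takiff_br_mem)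
  show "lie_br (takiff L n) (lie_scale (takiff L n) c x) y
      = lie_scale (takiff L n) c (lie_br (takiff L n) x y)" for c
    using x y by (auto simp: poly_eq_iff coeff_takiff_br scale_mem coeff_takiff_scale br_scale_left
        mem V.scale_sum_right)
  show "lie_br (takiff L n) x (lie_scale (takiff L n) c y)
      = lie_scale (takiff L n) c (lie_br (takiff L n) x y)" for c
    using x y by (auto simp: poly_eq_iff coeff_takiff_br scale_mem coeff_takiff_scale br_scale_right
        mem V.scale_sum_right)
  show "lie_br (takiff L n) x x = 0"
  proof -
    have "(\<Sum>i\<le>k. lie_br L (coeff x i) (coeff x (k - i))) = 0" (is "?s = 0") for k
    proof -
      have "?s = (\<Sum>i\<le>k. lie_br L (coeff x (k - i)) (coeff x i))"
        by (rule sum.reindex_bij_witness[where i = "\<lambda>i. k - i" and j = "\<lambda>i. k - i"]) auto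
      also have "\<dots> = (\<Sum>i\<le>k. - lie_br L (coeff x i) (coeff x (k - i)))"
        by (rule sum.cong[OF refl], rule br_anticommute) (auto simp: mem x)
      also have "\<dots> = - ?s"
        by (rule sum_negf)
      finally have "lie_scale L 2 ?s = 0"
        using V.scale_left_distrib[of 1 1 ?s] by (simp add: eq_neg_iff_add_eq_0)
      then show ?thesis by simp
    qed
    then show ?thesis
      using x by (auto simp: poly_eq_iff coeff_takiff_br)
  qed
  assume z: "z \<in> ?T"
  show "lie_br (takiff L n) (x + y) z = lie_br (takiff L n) x z + lie_br (takiff L n) y z"
    using x y z by (auto simp: poly_eq_iff coeff_takiff_br add_mem br_add_left mem sum.distrib)
  show "lie_br (takiff L n) x (y + z) = lie_br (takiff L n) x y + lie_br (takiff L n) x z"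
    using x y z by (auto simp: poly_eq_iff coeff_takiff_br add_mem br_add_right mem sum.distrib)
  let ?J = "\<lambda>x y z i j l. lie_br L (coeff x i) (lie_br L (coeff y j) (coeff z l))"
  have J: "coeff (lie_br (takiff L n) x (lie_br (takiff L n) y z)) k
      = (\<Sum>i\<le>k. \<Sum>j\<le>k - i. ?J x y z i j (k - i - j))"
    if "k \<le> n" "x \<in> ?T" "y \<in> ?T" "z \<in> ?T" for k x y z
  proof -
    have "lie_br L (coeff x i) (coeff (lie_br (takiff L n) y z) (k - i))
        = (\<Sum>j\<le>k - i. ?J x y z i j (k - i - j))" for i
      using that by (simp add: coeff_takiff_br br_sum_right mem br_closed diff_le_self[THEN order_trans])
    then show ?thesis
      using that by (simp add: coeff_takiff_br[of x] takiff_br_mem)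
  qed
  have "coeff (lie_br (takiff L n) x (lie_br (takiff L n) y z)
      + lie_br (takiff L n) y (lie_br (takiff L n) z x)
      + lie_br (takiff L n) z (lie_br (takiff L n) x y)) k = 0" for k
  proof (cases "k \<le> n")
    case True
    have 2: "(\<Sum>i\<le>k. \<Sum>j\<le>k - i. ?J y z x i j (k - i - j)) = (\<Sum>i\<le>k. \<Sum>j\<le>k - i. ?J y z x j (k - i - j) i)"
      by (rule sum_cyclic[of "?J y z x"])
    have 3: "(\<Sum>i\<le>k. \<Sum>j\<le>k - i. ?J z x y i j (k - i - j)) = (\<Sum>i\<le>k. \<Sum>j\<le>k - i. ?J z x y (k - i - j) i j)"
      by (rule sum_cyclic[symmetric, of "\<lambda>i j l. ?J z x y l i j"])
    show ?thesis
      unfolding coeff_add J[OF True x y z] J[OF True y z x] J[OF True z x y] 2 3 sum.distrib[symmetric]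
      by (intro sum.neutral ballI jacobi mem x y z)
  next
    case False
    then show ?thesis using x y z by (simp add: coeff_takiff_br takiff_br_mem)
  qed
  then show "lie_br (takiff L n) x (lie_br (takiff L n) y z)
      + lie_br (takiff L n) y (lie_br (takiff L n) z x)
      + lie_br (takiff L n) z (lie_br (takiff L n) x y) = 0"
    by (simp add: poly_eq_iff)
qed

end
section \<open>Automorphisms respecting the filtration by powers of \<open>T\<close>\<close>

text \<open>
  The equivalence, rather than an implication, says that the inverse respects the filtration too.
\<close>

definition filtered_aut :: "'a::ab_group_add lie_alg \<Rightarrow> nat \<Rightarrow> ('a poly \<Rightarrow> 'a poly) set" where
  "filtered_aut L n = {a \<in> lie_aut (takiff L n).
     \<forall>u\<in>lie_space (takiff L n). \<forall>v\<in>lie_space (takiff L n). \<forall>m.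
       jet m (a u) = jet m (a v) \<longleftrightarrow> jet m u = jet m v}"

lemma filtered_aut_jet_iff:
  assumes "a \<in> filtered_aut L n" "u \<in> lie_space (takiff L n)" "v \<in> lie_space (takiff L n)"
  shows "jet m (a u) = jet m (a v) \<longleftrightarrow> jet m u = jet m v"
  using assms by (simp add: filtered_aut_def)

lemma filtered_aut_lie_aut: "a \<in> filtered_aut L n \<Longrightarrow> a \<in> lie_aut (takiff L n)"
  by (simp add: filtered_aut_def)

context fd_lie_algebra
begin

lemma filtered_aut_compose:
  assumes a: "a \<in> filtered_aut L n" and b: "b \<in> filtered_aut L n"
  shows "compose (lie_space (takiff L n)) a b \<in> filtered_aut L n"
proof -
  interpret T: fd_lie_algebra "takiff L n" by (rule fd_lie_algebra_takiff)
  have "jet m (a (b u)) = jet m (a (b v)) \<longleftrightarrow> jet m u = jet m v"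
    if "u \<in> lie_space (takiff L n)" "v \<in> lie_space (takiff L n)" for u v m
    using that
    by (simp add: filtered_aut_jet_iff[OF a] filtered_aut_jet_iff[OF b]
        T.aut_mem[OF filtered_aut_lie_aut[OF b]])
  then show ?thesis
    using T.aut_compose[OF filtered_aut_lie_aut[OF a] filtered_aut_lie_aut[OF b]]
    by (simp add: filtered_aut_def compose_def)
qed

lemma filtered_aut_one: "(\<lambda>v\<in>lie_space (takiff L n). v) \<in> filtered_aut L n"
proof -
  interpret T: fd_lie_algebra "takiff L n" by (rule fd_lie_algebra_takiff)
  show ?thesis
    using T.aut_one by (simp add: filtered_aut_def)
qed

lemma takiff_mono: "m \<le> n \<Longrightarrow> p \<in> lie_space (takiff L m) \<Longrightarrow> p \<in> lie_space (takiff L n)"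
  by (simp add: takiff_mem_iff)

lemma jet_takiff_mem: "p \<in> lie_space (takiff L n) \<Longrightarrow> jet m p \<in> lie_space (takiff L m)"
  by (simp add: takiff_mem_iff coeff_jet zero_mem)

lemma jet_takiff_br:
  assumes "m \<le> n" "p \<in> lie_space (takiff L n)" "q \<in> lie_space (takiff L n)"
  shows "jet m (lie_br (takiff L n) p q) = lie_br (takiff L m) (jet m p) (jet m q)"
  using assms
  by (auto simp: poly_eq_iff coeff_jet coeff_takiff_br
      coeff_takiff_br[OF jet_takiff_mem jet_takiff_mem] intro!: sum.cong)

text \<open>
  The Takiff algebra of level \<open>m\<close> is the quotient of the one of level \<open>n\<close> by a step of the filtration;
  on the representatives chosen here the induced map is \<open>jet m \<circ> a\<close>.
\<close>

lemma filtered_aut_truncate: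
  assumes a: "a \<in> filtered_aut L n" and mn: "m \<le> n"
  shows "(\<lambda>u\<in>lie_space (takiff L m). jet m (a u)) \<in> lie_aut (takiff L m)"
proof -
  interpret T: fd_lie_algebra "takiff L n" by (rule fd_lie_algebra_takiff)
  interpret M: fd_lie_algebra "takiff L m" by (rule fd_lie_algebra_takiff)
  let ?M = "lie_space (takiff L m)"
  let ?a = "\<lambda>u\<in>?M. jet m (a u)"
  have aT: "a \<in> lie_aut (takiff L n)" and aE: "a \<in> lie_End (takiff L n)"
    using filtered_aut_lie_aut[OF a] T.aut_End by simp_all
  note up = takiff_mono[OF mn]
  have mem: "jet m (a u) \<in> ?M" if "u \<in> ?M" for u
    using jet_takiff_mem T.aut_mem[OF aT up[OF that]] by blast
  have jet_a: "jet m (a (jet m u)) = jet m (a u)" if "u \<in> lie_space (takiff L n)" for u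
    using filtered_aut_jet_iff[OF a up[OF jet_takiff_mem[OF that]] that] by (simp add: jet_jet)
  have same_scale: "lie_scale (takiff L m) = lie_scale (takiff L n)"
    by (simp add: takiff_def)
  have jet_scale': "jet m (lie_scale (takiff L n) c p) = lie_scale (takiff L n) c (jet m p)" for c p
    by (simp add: poly_eq_iff coeff_jet coeff_takiff_scale)
  show ?thesis
  proof (rule M.lie_autI)
    show "?a \<in> lie_End (takiff L m)"
      unfolding lie_End_def
      by (auto simp: mem M.mem_add M.mem_scale)
        (auto simp: up T.End_add[OF aE] T.End_scale[OF aE] jet_add same_scale jet_scale')
    show "bij_betw ?a ?M ?M"
      unfolding bij_betw_def
    proof
      show "inj_on ?a ?M"
        using filtered_aut_jet_iff[OF a up up, of _ _ m]
        by (auto simp: inj_on_def jet_takiff)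
      show "?a ` ?M = ?M"
      proof
        show "?a ` ?M \<subseteq> ?M" using mem by auto
        show "?M \<subseteq> ?a ` ?M"
        proof
          fix w assume w: "w \<in> ?M"
          obtain u where u: "u \<in> lie_space (takiff L n)" "w = a u"
            using T.aut_bij[OF aT] up[OF w] unfolding bij_betw_def by blast
          have "?a (jet m u) = jet m w"
            using jet_takiff_mem[OF u(1)] jet_a[OF u(1)] u(2) by simp
          then show "w \<in> ?a ` ?M"
            using jet_takiff_mem[OF u(1)] jet_takiff[OF w] by (metis imageI)
        qed
      qed
    qed
    fix u v assume u: "u \<in> ?M" and v: "v \<in> ?M"
    have "jet m (a (lie_br (takiff L m) u v)) = jet m (a (lie_br (takiff L n) u v))"
      using jet_a[OF T.br_closed[OF up[OF u] up[OF v]]]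
      by (simp add: jet_takiff_br mn up u v jet_takiff[OF u] jet_takiff[OF v])
    then show "?a (lie_br (takiff L m) u v) = lie_br (takiff L m) (?a u) (?a v)"
      using u v by (simp add: M.br_closed T.aut_br[OF aT] up jet_takiff_br mn T.aut_mem[OF aT])
  qed
qed

lemma filtered_aut_dim_centralizer:
  assumes a: "a \<in> filtered_aut L n" and mn: "m \<le> n" and u: "u \<in> lie_space (takiff L n)"
  shows "lie_dim (takiff L m) (lie_centralizer (takiff L m) (jet m (a u)))
    = lie_dim (takiff L m) (lie_centralizer (takiff L m) (jet m u))"
proof -
  interpret M: fd_lie_algebra "takiff L m" by (rule fd_lie_algebra_takiff)
  note ju = jet_takiff_mem[OF u, of m]
  have "jet m (a (jet m u)) = jet m (a u)"
    using filtered_aut_jet_iff[OF a takiff_mono[OF mn ju] u] by (simp add: jet_jet)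
  then show ?thesis
    using M.aut_dim_centralizer[OF filtered_aut_truncate[OF a mn] ju] ju by simp
qed

lemma coeff_br_monom:
  assumes y: "y \<in> lie_space L" and k: "k \<le> n" and p: "p \<in> lie_space (takiff L n)"
  shows "coeff (lie_br (takiff L n) (monom y k) p) j
    = (if k \<le> j \<and> j \<le> n then lie_br L y (coeff p (j - k)) else 0)"
proof -
  have "monom y k \<in> lie_space (takiff L n)"
    using y k by (simp add: takiff_mem_iff zero_mem)
  then have "coeff (lie_br (takiff L n) (monom y k) p) j
      = (if j \<le> n then \<Sum>i\<le>j. lie_br L (if k = i then y else 0) (coeff p (j - i)) else 0)"
    using p by (simp add: coeff_takiff_br)
  also have "(\<Sum>i\<le>j. lie_br L (if k = i then y else 0) (coeff p (j - i)))
      = (\<Sum>i\<le>j. if k = i then lie_br L y (coeff p (j - i)) else 0)"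
    using p by (intro sum.cong) (simp_all add: takiff_mem_iff br_0_left)
  finally show ?thesis
    by simp
qed

text \<open>
  Here \<open>e'\<close> is \<open>exp (ad (y T\<^sup>k))\<close> and \<open>e\<close> is its inverse.  The inverse is the map that transports the
  simplified element back to the original one, so the group and filtration properties are
  stated for it, and the effect on coefficients for \<open>e'\<close>.  As \<open>k > 0\<close>, the operator
  \<open>ad (y T\<^sup>k)\<close> raises degrees, so it is nilpotent on polynomials cut off at degree \<open>n\<close>.
\<close>

lemma exp_monom:
  assumes y: "y \<in> lie_space L" and k: "0 < k" "k \<le> n"
  obtains e e' where
    "e \<in> algebraic_adjoint_group (takiff L n)" "e \<in> filtered_aut L n"
    "\<And>p. p \<in> lie_space (takiff L n) \<Longrightarrow> e' p \<in> lie_space (takiff L n) \<and> e (e' p) = p"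
    "\<And>p j. p \<in> lie_space (takiff L n) \<Longrightarrow> j < k \<Longrightarrow> coeff (e' p) j = coeff p j"
    "\<And>p. p \<in> lie_space (takiff L n) \<Longrightarrow> coeff (e' p) k = coeff p k + lie_br L y (coeff p 0)"
proof -
  interpret T: fd_lie_algebra "takiff L n" by (rule fd_lie_algebra_takiff)
  let ?T = "lie_space (takiff L n)"
  define X where "X = lie_ad (takiff L n) (monom y k)"
  have mon: "monom y k \<in> ?T"
    using y k by (simp add: takiff_mem_iff zero_mem)
  have XE: "X \<in> lie_End (takiff L n)"
    unfolding X_def by (rule T.lie_ad_End[OF mon])
  note pow_mem = T.End_pow_mem[OF XE]
  have coeff_X: "coeff (X p) j = (if k \<le> j \<and> j \<le> n then lie_br L y (coeff p (j - k)) else 0)"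
    if "p \<in> ?T" for p j
    using that by (simp add: X_def lie_ad_def coeff_br_monom y k)
  have low: "coeff ((X ^^ i) p) j = 0" if "p \<in> ?T" "j < i" for i p j
    using that(2)
  proof (induction i arbitrary: j)
    case (Suc i)
    then have "coeff ((X ^^ i) p) (j - k) = 0" if "k \<le> j"
      using k that by (intro Suc.IH) auto
    then show ?case
      by (simp add: coeff_X pow_mem that(1) br_0_right y)
  qed simp
  interpret N: nilpotent_endomorphism "takiff L n" X "Suc n"
  proof
    show "(X ^^ Suc n) v = 0" if "v \<in> ?T" for v
    proof (rule poly_eqI)
      fix j
      show "coeff ((X ^^ Suc n) v) j = coeff 0 j"
        using low[OF that, of j "Suc n"] pow_mem[OF that, of "Suc n"]
        unfolding takiff_mem_iff coeff_0 by (cases "j \<le> n") auto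
    qed
  qed (rule XE)
  let ?e = "nilexp (takiff L n) (Suc n) X"
  have coeff_e: "coeff (?e t p) j = (\<Sum>i<Suc n. lie_scale L (t ^ i / fact i) (coeff ((X ^^ i) p) j))"
    if "p \<in> ?T" for t p j
    using that by (simp add: nilexp_def coeff_sum coeff_takiff_scale del: sum.lessThan_Suc)
  have pow_cong: "\<forall>j\<le>m. coeff ((X ^^ i) u) j = coeff ((X ^^ i) v) j"
    if "\<forall>j\<le>m. coeff u j = coeff v j" "u \<in> ?T" "v \<in> ?T" for u v m i
  proof (induction i)
    case (Suc i)
    then show ?case by (simp add: coeff_X pow_mem that(2,3))
  qed (use that in simp)
  have e_cong: "jet m (?e t u) = jet m (?e t v)" if "jet m u = jet m v" "u \<in> ?T" "v \<in> ?T" for u v t m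
    unfolding jet_eq_iff
  proof (intro allI impI)
    fix j assume "j \<le> m"
    then have "coeff ((X ^^ i) u) j = coeff ((X ^^ i) v) j" for i
      using pow_cong[OF that(1)[unfolded jet_eq_iff] that(2,3)] by blast
    then show "coeff (?e t u) j = coeff (?e t v) j"
      unfolding coeff_e[OF that(2)] coeff_e[OF that(3)] by simp
  qed
  have inv: "?e s (?e t u) = u" if "u \<in> ?T" "s + t = 0" for u s t
    using that by (simp add: N.nilexp_add N.nilexp_0)
  have "jet m u = jet m v" if "jet m (?e (- 1) u) = jet m (?e (- 1) v)" "u \<in> ?T" "v \<in> ?T" for u v m
    using e_cong[OF that(1), of 1] that(2,3) by (simp add: inv N.nilexp_mem)
  then have filt: "?e (- 1) \<in> filtered_aut L n"
    using N.nilexp_ad(2)[OF mon X_def] e_cong unfolding filtered_aut_def by blast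
  show thesis
  proof (rule that[of "?e (- 1)" "?e 1"])
    show "?e (- 1) \<in> algebraic_adjoint_group (takiff L n)"
      by (rule N.nilexp_ad(1)[OF mon X_def])
    fix p assume p: "p \<in> ?T"
    show "?e 1 p \<in> ?T \<and> ?e (- 1) (?e 1 p) = p"
      using p by (simp add: inv N.nilexp_mem)
    have Suc0: "coeff ((X ^^ Suc i) p) j = 0" if "j < k" for i j
      using that by (simp add: coeff_X pow_mem p)
    show "coeff (?e 1 p) j = coeff p j" if "j < k" for j
      unfolding coeff_e[OF p] sum.lessThan_Suc_shift using Suc0[OF that]
      by (simp del: funpow.simps(2))
    \<comment> \<open>In degree \<open>k\<close> only the constant and the linear term of the exponential contribute.\<close>
    have two: "(\<Sum>i<Suc n. F i) = F 0 + F (Suc 0)" if "\<And>i. F (Suc (Suc i)) = 0"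
      for F :: "nat \<Rightarrow> 'a"
    proof -
      have "(\<Sum>i<Suc n. F i) = (\<Sum>i\<in>{0, Suc 0}. F i)"
      proof (rule sum.mono_neutral_right)
        show "\<forall>i\<in>{..<Suc n} - {0, Suc 0}. F i = 0"
        proof
          fix i assume "i \<in> {..<Suc n} - {0, Suc 0}"
          then have "i = Suc (Suc (i - 2))" by auto
          then show "F i = 0" using that by metis
        qed
      qed (use k in auto)
      then show ?thesis by simp
    qed
    have Suc2: "coeff ((X ^^ Suc (Suc i)) p) k = 0" for i
      using Suc0[of 0 i] k pow_mem[OF p, of "Suc i"] by (simp add: coeff_X br_0_right y)
    show "coeff (?e 1 p) k = coeff p k + lie_br L y (coeff p 0)"
      unfolding coeff_e[OF p] by (subst two) (simp_all only: Suc2 V.scale_zero_right,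
        use k in \<open>simp add: coeff_X p\<close>)
  qed (fact filt)
qed

end
section \<open>The centralizer of the semisimple part\<close>

context fd_lie_algebra
begin

lemma diagonalizable_split:
  assumes "ad_diagonalizable L z" and z: "z \<in> lie_space L" and v: "v \<in> lie_space L"
  shows "\<exists>s\<in>lie_centralizer L z. \<exists>w\<in>lie_space L. v = s + lie_br L z w"
proof -
  obtain B where B: "V.span B = lie_space L" "\<And>b. b \<in> B \<Longrightarrow> \<exists>c. lie_br L z b = lie_scale L c b"
    using assms(1) by (auto simp: ad_diagonalizable_def)
  have "v \<in> V.span B" using v B(1) by simp
  then show ?thesis
  proof (induction rule: V.span_induct_alt)
    case base
    have "0 \<in> lie_centralizer L z"
      using z by (simp add: lie_centralizer_def zero_mem br_0_right)
    then show ?case using z br_0_right zero_mem by force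
  next
    case (step c b v)
    then obtain s w where sw: "s \<in> lie_centralizer L z" "w \<in> lie_space L" "v = s + lie_br L z w"
      by blast
    have b: "b \<in> lie_space L"
      using step(1) B(1) V.span_base by blast
    obtain \<mu> where \<mu>: "lie_br L z b = lie_scale L \<mu> b"
      using B(2) step(1) by blast
    show ?case
    proof (cases "\<mu> = 0")
      case True
      then have "lie_scale L c b + s \<in> lie_centralizer L z"
        using sw(1) b z \<mu> by (simp add: lie_centralizer_def mem_add mem_scale br_add_right br_scale_right)
      then show ?thesis
        using sw(2,3) by (metis add.assoc)
    next
      case False
      then have "lie_scale L c b + v = s + lie_br L z (lie_scale L (c / \<mu>) b + w)"
        using sw(2,3) b z \<mu> by (simp add: br_add_right br_scale_right mem_scale algebra_simps)
      then show ?thesis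
        using sw(1,2) b by (metis mem_add mem_scale)
    qed
  qed
qed

lemma diagonalizable_kernel_square:
  assumes "ad_diagonalizable L z" and z: "z \<in> lie_space L" and v: "v \<in> lie_space L"
    and zz: "lie_br L z (lie_br L z v) = 0"
  shows "lie_br L z v = 0"
proof -
  obtain B where B: "\<not> V.dependent B" "V.span B = lie_space L"
    "\<And>b. b \<in> B \<Longrightarrow> \<exists>c. lie_br L z b = lie_scale L c b"
    using assms(1) by (auto simp: ad_diagonalizable_def)
  obtain \<mu> where \<mu>: "\<And>b. b \<in> B \<Longrightarrow> lie_br L z b = lie_scale L (\<mu> b) b"
    using B(3) by metis
  define R where "R = {b. V.representation B v b \<noteq> 0}"
  have R: "finite R" "R \<subseteq> B"
    unfolding R_def using V.finite_representation V.representation_ne_zero by blast+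
  define c where "c = V.representation B v"
  have v_eq: "v = (\<Sum>b\<in>R. lie_scale L (c b) b)"
    using V.sum_nonzero_representation_eq[OF B(1), of v] v B(2) unfolding R_def c_def by simp
  have mem: "b \<in> lie_space L" if "b \<in> R" for b
    using that R(2) B(2) V.span_base by blast
  have ad_sum: "lie_br L z (\<Sum>b\<in>R. lie_scale L (f b) b) = (\<Sum>b\<in>R. lie_scale L (f b * \<mu> b) b)" for f
    using R(2) by (subst br_sum_right)
      (auto simp: z mem mem_scale br_scale_right \<mu> intro!: sum.cong)
  have "(\<Sum>b\<in>R. lie_scale L (c b * \<mu> b * \<mu> b) b) = 0"
    using zz unfolding v_eq ad_sum .
  then have "c b * \<mu> b * \<mu> b = 0" if "b \<in> R" for b
    using V.independentD[OF B(1) R, of "\<lambda>b. c b * \<mu> b * \<mu> b"] that by blast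
  then have "lie_scale L (c b * \<mu> b) b = 0" if "b \<in> R" for b
    using that by auto
  then show ?thesis
    unfolding v_eq ad_sum by (rule sum.neutral[OF ballI])
qed

end

locale jordan_decomposed = fd_lie_algebra L for L :: "'a::ab_group_add lie_alg" +
  fixes x0 xss xnil :: 'a
  assumes jordan: "jordan_decomposition L x0 xss xnil"
begin

abbreviation "S \<equiv> centralizer_subalgebra L xss"

lemma xss_mem: "xss \<in> lie_space L"
  using jordan by (simp add: jordan_decomposition_def)

lemma xnil_mem: "xnil \<in> lie_space L"
proof -
  have "br_span L (lie_space L) (lie_space L) \<subseteq> lie_space L"
    unfolding br_span_def by (rule V.span_minimal[OF _ subspace]) (auto simp: br_closed)
  then show ?thesis
    using jordan by (auto simp: jordan_decomposition_def)
qed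

lemma x0_eq: "x0 = xss + xnil"
  using jordan by (simp add: jordan_decomposition_def)

lemma x0_mem: "x0 \<in> lie_space L"
  by (simp add: x0_eq mem_add xss_mem xnil_mem)

lemma diag: "ad_diagonalizable L xss"
  using jordan by (simp add: jordan_decomposition_def)

lemma br_x0: "v \<in> lie_space L \<Longrightarrow> lie_br L x0 v = lie_br L xss v + lie_br L xnil v"
  by (simp add: x0_eq br_add_left xss_mem xnil_mem)

lemma S_mem: "v \<in> lie_space S \<longleftrightarrow> v \<in> lie_space L \<and> lie_br L xss v = 0"
  by (simp add: centralizer_subalgebra_def lie_centralizer_def)

lemma S_add: "u \<in> lie_space S \<Longrightarrow> v \<in> lie_space S \<Longrightarrow> u + v \<in> lie_space S"
  by (simp add: S_mem mem_add br_add_right xss_mem)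

lemma S_diff: "u \<in> lie_space S \<Longrightarrow> v \<in> lie_space S \<Longrightarrow> u - v \<in> lie_space S"
  by (simp add: S_mem mem_diff br_diff_right xss_mem)

lemma S_zero: "0 \<in> lie_space S"
  by (simp add: S_mem zero_mem br_0_right xss_mem)

lemma S_br: "u \<in> lie_space S \<Longrightarrow> v \<in> lie_space S \<Longrightarrow> lie_br L u v \<in> lie_space S"
  using br_derivation[of xss u v]
  by (simp add: S_mem br_closed xss_mem br_0_left br_0_right)

lemma S_sum: "(\<And>i. i \<in> A \<Longrightarrow> v i \<in> lie_space S) \<Longrightarrow> (\<Sum>i\<in>A. v i) \<in> lie_space S"
  by (induction A rule: infinite_finite_induct) (auto simp: S_zero S_add)

lemma xss_S: "xss \<in> lie_space S"
  by (simp add: S_mem xss_mem br_self)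

lemma xnil_S: "xnil \<in> lie_space S"
  using jordan by (simp add: S_mem xnil_mem jordan_decomposition_def)

lemma xnil_pow_mem: "v \<in> lie_space L \<Longrightarrow> (lie_br L xnil ^^ j) v \<in> lie_space L"
  by (induction j) (auto simp: br_closed xnil_mem)

lemma xnil_pow_add:
  "u \<in> lie_space L \<Longrightarrow> v \<in> lie_space L \<Longrightarrow>
    (lie_br L xnil ^^ j) (u + v) = (lie_br L xnil ^^ j) u + (lie_br L xnil ^^ j) v"
  by (induction j) (auto simp: br_add_right xnil_mem xnil_pow_mem)

lemma xss_xnil_pow_commute:
  "v \<in> lie_space L \<Longrightarrow> lie_br L xss ((lie_br L xnil ^^ j) v) = (lie_br L xnil ^^ j) (lie_br L xss v)"
proof (induction j)
  case (Suc j)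
  have "lie_br L xss xnil = 0"
    using xnil_S by (simp add: S_mem)
  then show ?case
    using br_derivation[OF xss_mem xnil_mem xnil_pow_mem[OF Suc.prems, of j]] Suc
    by (simp add: br_0_left xnil_pow_mem)
qed simp

lemma xnil_nilpotent: "\<exists>K. \<forall>v\<in>lie_space L. (lie_br L xnil ^^ K) v = 0"
  using jordan by (simp add: jordan_decomposition_def ad_nilpotent_def)

text \<open>
  Modulo \<open>\<ss> + [x\<^sub>0, \<gg>]\<close> the image of \<open>ad xss\<close> agrees with that of \<open>ad xnil\<close>, and
  \<open>\<gg> = \<ss> + [xss, \<gg>]\<close>.  So every \<open>(ad xnil)\<^sup>j z\<close> is congruent to some \<open>(ad xnil)\<^sup>j\<^sup>+\<^sup>1 w\<close> up to sign;
  descending from the power that vanishes, one arrives at \<open>j = 0\<close>.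
\<close>

lemma centralizer_plus_ad_image:
  assumes z: "z \<in> lie_space L"
  shows "\<exists>s\<in>lie_space S. \<exists>y\<in>lie_space L. z = s + lie_br L x0 y"
proof -
  let ?N = "lie_br L xnil"
  obtain K where K: "\<And>v. v \<in> lie_space L \<Longrightarrow> (?N ^^ K) v = 0"
    using xnil_nilpotent by blast
  have "\<forall>z\<in>lie_space L. \<exists>s\<in>lie_space S. \<exists>y\<in>lie_space L. (?N ^^ 0) z = s + lie_br L x0 y"
  proof (rule inc_induct[of 0 K])
    show "\<forall>z\<in>lie_space L. \<exists>s\<in>lie_space S. \<exists>y\<in>lie_space L. (?N ^^ K) z = s + lie_br L x0 y"
      using K S_zero zero_mem br_0_right[OF x0_mem] by force
  next
    fix j
    assume IH: "\<forall>z\<in>lie_space L. \<exists>s\<in>lie_space S. \<exists>y\<in>lie_space L. (?N ^^ Suc j) z = s + lie_br L x0 y"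
    show "\<forall>z\<in>lie_space L. \<exists>s\<in>lie_space S. \<exists>y\<in>lie_space L. (?N ^^ j) z = s + lie_br L x0 y"
    proof
      fix z assume "z \<in> lie_space L"
      then obtain s w where sw: "s \<in> lie_space S" "w \<in> lie_space L" "z = s + lie_br L xss w"
        using diagonalizable_split[OF diag xss_mem, of z]
        by (auto simp: centralizer_subalgebra_def)
      then obtain s' y where sy: "s' \<in> lie_space S" "y \<in> lie_space L"
        "(?N ^^ Suc j) w = s' + lie_br L x0 y"
        using IH by blast
      have sL: "s \<in> lie_space L" using sw(1) by (simp add: S_mem)
      have "(?N ^^ j) z = (?N ^^ j) s + lie_br L xss ((?N ^^ j) w)"
        using sw by (simp add: xnil_pow_add sL br_closed xss_mem xss_xnil_pow_commute)
      also have "lie_br L xss ((?N ^^ j) w) = lie_br L x0 ((?N ^^ j) w) - (?N ^^ Suc j) w"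
        using sw(2) by (simp add: br_x0 xnil_pow_mem)
      also have "(?N ^^ j) s + \<dots> = ((?N ^^ j) s - s') + lie_br L x0 ((?N ^^ j) w - y)"
        unfolding sy(3) using sy(2) sw(2) by (simp add: br_diff_right x0_mem xnil_pow_mem)
      finally have "(?N ^^ j) z = ((?N ^^ j) s - s') + lie_br L x0 ((?N ^^ j) w - y)" .
      moreover have "(?N ^^ j) s \<in> lie_space S"
        using sw(1) by (induction j) (auto simp: S_br xnil_S)
      then have "(?N ^^ j) s - s' \<in> lie_space S"
        using sy(1) by (rule S_diff)
      moreover have "(?N ^^ j) w - y \<in> lie_space L"
        using sw(2) sy(2) by (intro mem_diff xnil_pow_mem)
      ultimately show "\<exists>s\<in>lie_space S. \<exists>y\<in>lie_space L. (?N ^^ j) z = s + lie_br L x0 y"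
        by blast
    qed
  qed simp
  then show ?thesis using z by simp
qed

text \<open>
  For \<open>c = [xss, b]\<close> the hypothesis says \<open>[xss, c] = - [xnil, c]\<close>.  If \<open>(ad xnil)\<^sup>j\<^sup>+\<^sup>1 c = 0\<close>, then
  \<open>(ad xss)\<^sup>2\<close> kills \<open>(ad xnil)\<^sup>j b\<close>; as \<open>ad xss\<close> is diagonalizable it kills that element itself,
  which means \<open>(ad xnil)\<^sup>j c = 0\<close>.  Descending to \<open>j = 0\<close> gives \<open>c = 0\<close>.
\<close>

lemma mem_centralizer_if_br_mem_centralizer:
  assumes b: "b \<in> lie_space L" and S: "lie_br L x0 b \<in> lie_space S"
  shows "b \<in> lie_space S"
proof -
  let ?N = "lie_br L xnil"
  obtain K where K: "\<And>v. v \<in> lie_space L \<Longrightarrow> (?N ^^ K) v = 0"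
    using xnil_nilpotent by blast
  define c where "c = lie_br L xss b"
  have c: "c \<in> lie_space L" by (simp add: c_def br_closed b xss_mem)
  have Nb: "lie_br L xnil b \<in> lie_space L" by (simp add: br_closed b xnil_mem)
  have "lie_br L xss c + lie_br L xss (?N b) = 0"
    using S b c Nb by (simp add: S_mem br_x0 br_add_right xss_mem c_def)
  moreover have "lie_br L xss (?N b) = ?N c"
    using xss_xnil_pow_commute[OF b, of 1] by (simp add: c_def)
  ultimately have Dc: "lie_br L xss c = - ?N c"
    by (simp add: eq_neg_iff_add_eq_0)
  have "(?N ^^ 0) c = 0"
  proof (rule inc_induct[of 0 K])
    show "(?N ^^ K) c = 0" using K c by simp
  next
    fix j assume IH: "(?N ^^ Suc j) c = 0"
    have "lie_br L xss ((?N ^^ j) c) = (?N ^^ j) (- ?N c)"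
      by (simp add: xss_xnil_pow_commute c Dc)
    also have "\<dots> = - (?N ^^ Suc j) c"
    proof -
      have "(?N ^^ j) (- ?N c) + (?N ^^ j) (?N c) = (?N ^^ j) 0"
        using xnil_pow_add[of "- ?N c" "?N c" j] by (simp add: br_closed c xnil_mem mem_neg)
      moreover have "(?N ^^ j) 0 = 0"
        by (induction j) (auto simp: br_0_right xnil_mem)
      ultimately show ?thesis
        by (simp add: funpow_swap1 eq_neg_iff_add_eq_0)
    qed
    finally have "lie_br L xss (lie_br L xss ((?N ^^ j) b)) = 0"
      using IH b by (simp add: xss_xnil_pow_commute xnil_pow_mem c_def)
    then have "lie_br L xss ((?N ^^ j) b) = 0"
      by (rule diagonalizable_kernel_square[OF diag xss_mem xnil_pow_mem[OF b]])
    then show "(?N ^^ j) c = 0"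
      by (simp add: c_def xss_xnil_pow_commute b)
  qed simp
  then show ?thesis
    using b by (simp add: S_mem c_def)
qed

lemma takiff_S_br: "lie_br (takiff S n) = lie_br (takiff L n)"
  by (simp add: takiff_def current_def centralizer_subalgebra_def)

lemma takiff_S_scale: "lie_scale (takiff S n) = lie_scale (takiff L n)"
  by (simp add: takiff_def current_def centralizer_subalgebra_def)

lemma takiff_S_mem: "p \<in> lie_space (takiff S n) \<Longrightarrow> p \<in> lie_space (takiff L n)"
  by (simp add: takiff_mem_iff S_mem)

section \<open>Moving elements into the centralizer\<close>

text \<open>
  In each degree \<open>k > m\<close> the coefficient is written as \<open>s + [x\<^sub>0, y]\<close> with \<open>s \<in> \<ss>\<close>, and
  \<open>exp (ad (y T\<^sup>k))\<close> removes \<open>[x\<^sub>0, y]\<close>.  The version with \<open>m = 0\<close> produces the element of the theorem;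
  larger \<open>m\<close> are needed for the modalities, where an \<open>m\<close>-jet that is already in \<open>\<ss>\<close> must be kept.
\<close>

lemma normal_form:
  assumes p: "p \<in> lie_space (takiff L n)" and p0: "coeff p 0 = x0"
    and pm: "\<And>j. j \<le> m \<Longrightarrow> coeff p j \<in> lie_space S" and mn: "m \<le> n"
  obtains a q where "a \<in> algebraic_adjoint_group (takiff L n)" "a \<in> filtered_aut L n"
    "q \<in> lie_space (takiff S n)" "jet m q = jet m p" "a q = p"
proof -
  interpret T: fd_lie_algebra "takiff L n" by (rule fd_lie_algebra_takiff)
  let ?T = "lie_space (takiff L n)"
  let ?P = "\<lambda>k. \<exists>a q. a \<in> algebraic_adjoint_group (takiff L n) \<and> a \<in> filtered_aut L n \<and>
    q \<in> ?T \<and> (\<forall>j\<le>k. coeff q j \<in> lie_space S) \<and> jet m q = jet m p \<and> a q = p"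
  have "k \<le> n \<Longrightarrow> ?P k" if "m \<le> k" for k
    using that
  proof (induction k rule: dec_induct)
    case base
    show ?case
      by (intro exI[of _ "\<lambda>v\<in>?T. v"] exI[of _ p] conjI T.adjoint_group_one filtered_aut_one)
        (use p pm in auto)
  next
    case (step k)
    then obtain a q where a: "a \<in> algebraic_adjoint_group (takiff L n)" "a \<in> filtered_aut L n"
      and q: "q \<in> ?T" "\<And>j. j \<le> k \<Longrightarrow> coeff q j \<in> lie_space S" "jet m q = jet m p" "a q = p"
      using Suc_leD by blast
    have q0: "coeff q 0 = x0"
      using q(3) p0 by (simp add: jet_eq_iff)
    obtain s y where sy: "s \<in> lie_space S" "y \<in> lie_space L" "coeff q (Suc k) = s + lie_br L x0 y"
      using centralizer_plus_ad_image[of "coeff q (Suc k)"] q(1) by (auto simp: takiff_mem_iff)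
    obtain e e' where e: "e \<in> algebraic_adjoint_group (takiff L n)" "e \<in> filtered_aut L n"
      "\<And>p. p \<in> ?T \<Longrightarrow> e' p \<in> ?T \<and> e (e' p) = p"
      "\<And>p j. p \<in> ?T \<Longrightarrow> j < Suc k \<Longrightarrow> coeff (e' p) j = coeff p j"
      "\<And>p. p \<in> ?T \<Longrightarrow> coeff (e' p) (Suc k) = coeff p (Suc k) + lie_br L y (coeff p 0)"
      using exp_monom[OF sy(2), of "Suc k" n] step.prems by auto
    have "coeff (e' q) (Suc k) = s"
      using e(5)[OF q(1)] sy(3) br_anticommute[OF sy(2) x0_mem] by (simp add: q0)
    then have "coeff (e' q) j \<in> lie_space S" if "j \<le> Suc k" for j
      using that e(4)[OF q(1), of j] q(2)[of j] sy(1) by (cases "j = Suc k") auto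
    moreover have "jet m (e' q) = jet m p"
      using e(4)[OF q(1)] step(1) q(3) by (simp add: jet_eq_iff)
    moreover have "compose ?T a e (e' q) = p"
      using e(3)[OF q(1)] q(4) by (simp add: compose_def)
    moreover have "compose ?T a e \<in> algebraic_adjoint_group (takiff L n)"
      by (rule T.adjoint_group_compose) (intro a(1) e(1) filtered_aut_lie_aut[OF a(2)] filtered_aut_lie_aut[OF e(2)])+
    moreover have "compose ?T a e \<in> filtered_aut L n"
      by (rule filtered_aut_compose[OF a(2) e(2)])
    ultimately show ?case
      using e(3)[OF q(1)] by blast
  qed
  from this[OF mn order_refl] obtain a q where aq: "a \<in> algebraic_adjoint_group (takiff L n)" "a \<in> filtered_aut L n"
    "q \<in> ?T" "\<forall>j\<le>n. coeff q j \<in> lie_space S" "jet m q = jet m p" "a q = p"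
    by blast
  then have "q \<in> lie_space (takiff S n)"
    using S_zero unfolding takiff_mem_iff by (metis not_le)
  with aq show thesis
    by (intro that)
qed

lemma current_S_iff: "p \<in> lie_space (current S) \<longleftrightarrow> (\<forall>k. coeff p k \<in> lie_space S)"
  by (simp add: current_def)

lemma coeff_xss: "coeff [:xss:] k = (if k = 0 then xss else 0)"
  by (cases k) simp_all

lemma takiff_add_xss:
  assumes p: "p \<in> lie_space (current S)"
  shows "jet n ([:xss:] + p) \<in> lie_space (takiff S n)"
  using p by (simp add: takiff_mem_iff coeff_jet coeff_xss current_S_iff S_zero S_add xss_S)

text \<open>
  The coefficients of an element \<open>r\<close> of the left-hand side lie in \<open>\<ss>\<close>, by induction on the degree:
  in degree \<open>k\<close> the commutation relation expresses \<open>[x\<^sub>0, r\<^sub>k]\<close> by brackets of elements of \<open>\<ss>\<close>.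
\<close>

lemma centralizer_eq:
  assumes p: "p \<in> lie_space (current S)" and p0: "coeff p 0 = xnil"
  shows "lie_centralizer (takiff L n) (jet n ([:xss:] + p)) = lie_centralizer (takiff S n) (jet n p)"
proof -
  interpret T: fd_lie_algebra "takiff L n" by (rule fd_lie_algebra_takiff)
  let ?q = "jet n ([:xss:] + p)"
  have q: "?q \<in> lie_space (takiff S n)" and jp: "jet n p \<in> lie_space (takiff S n)"
    using p by (simp_all add: takiff_add_xss) (simp add: takiff_mem_iff coeff_jet current_S_iff S_zero)
  have q0: "coeff ?q 0 = x0"
    by (simp add: coeff_jet coeff_xss p0 x0_eq)
  have xss: "[:xss:] \<in> lie_space (takiff L n)"
    by (simp add: takiff_mem_iff coeff_xss xss_mem zero_mem)
  have "?q = [:xss:] + jet n p"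
    by (auto simp: poly_eq_iff coeff_jet coeff_xss)
  then have br: "lie_br (takiff L n) ?q r
      = lie_br (takiff L n) [:xss:] r + lie_br (takiff L n) (jet n p) r"
    if "r \<in> lie_space (takiff L n)" for r
    using that by (simp add: T.br_add_left xss takiff_S_mem[OF jp])
  have br_xss: "lie_br (takiff L n) [:xss:] r = 0" if "r \<in> lie_space (takiff S n)" for r
    using that takiff_S_mem[OF that]
    by (simp add: poly_eq_iff monom_0[symmetric] coeff_br_monom xss_mem) (simp add: takiff_mem_iff S_mem)
  have in_S: "r \<in> lie_space (takiff S n)"
    if r: "r \<in> lie_space (takiff L n)" and r0: "lie_br (takiff L n) ?q r = 0" for r
  proof -
    have "coeff r k \<in> lie_space S" if "k \<le> n" for k
      using that
    proof (induction k rule: less_induct)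
      case (less k)
      have rL: "coeff r k \<in> lie_space L"
        using r by (simp add: takiff_mem_iff)
      let ?s = "\<Sum>i\<in>{1..k}. lie_br L (coeff ?q i) (coeff r (k - i))"
      have "(\<Sum>i\<le>k. lie_br L (coeff ?q i) (coeff r (k - i))) = 0"
        using coeff_takiff_br[OF takiff_S_mem[OF q] r, of k] r0 less.prems by simp
      also have "(\<Sum>i\<le>k. lie_br L (coeff ?q i) (coeff r (k - i))) = lie_br L x0 (coeff r k) + ?s"
        by (simp add: atMost_atLeast0 sum.atLeast_Suc_atMost q0)
      finally have "lie_br L x0 (coeff r k) = 0 - ?s"
        by (simp add: eq_neg_iff_add_eq_0)
      moreover have "?s \<in> lie_space S"
      proof (rule S_sum)
        fix i assume i: "i \<in> {1..k}"
        show "lie_br L (coeff ?q i) (coeff r (k - i)) \<in> lie_space S"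
        proof (rule S_br)
          show "coeff ?q i \<in> lie_space S"
            using q unfolding takiff_mem_iff by blast
          show "coeff r (k - i) \<in> lie_space S"
            using i less.prems by (intro less.IH) auto
        qed
      qed
      ultimately have "lie_br L x0 (coeff r k) \<in> lie_space S"
        using S_diff[OF S_zero] by metis
      then show ?case
        by (rule mem_centralizer_if_br_mem_centralizer[OF rL])
    qed
    then show ?thesis
      using r S_zero unfolding takiff_mem_iff by (metis not_le)
  qed
  have "lie_br (takiff L n) ?q r = lie_br (takiff L n) (jet n p) r"
    if "r \<in> lie_space (takiff S n)" for r
    by (simp only: br[OF takiff_S_mem[OF that]] br_xss[OF that] add_0_left)
  then show ?thesis
    unfolding lie_centralizer_def takiff_S_br using takiff_S_mem in_S by fastforce
qed

lemma dim_centralizer_eq: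
  assumes "p \<in> lie_space (current S)" "coeff p 0 = xnil"
  shows "lie_dim (takiff S n) (lie_centralizer (takiff S n) (jet n p))
    = lie_dim (takiff L n) (lie_centralizer (takiff L n) (jet n ([:xss:] + p)))"
  by (simp add: takiff_S_scale centralizer_eq assms)

lemma minus_xss_current:
  assumes "q \<in> lie_space (takiff S n)" "coeff q 0 = x0"
  shows "q - [:xss:] \<in> lie_space (current S)" "coeff (q - [:xss:]) 0 = xnil"
proof -
  have "coeff [:xss:] k \<in> lie_space S" for k
    by (cases k) (simp_all add: xss_S S_zero)
  then show "q - [:xss:] \<in> lie_space (current S)"
    using assms(1) by (simp add: current_S_iff S_diff takiff_mem_iff)
qed (simp add: assms(2) x0_eq)

text \<open>
  The two minima range over the same set of numbers.  An element \<open>y\<close> with the \<open>m\<close>-jet of \<open>x\<close> is pulled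
  back by \<open>a\<close>, which gives it the \<open>m\<close>-jet of \<open>q\<close>, and is then put into normal form keeping
  this jet; conversely \<open>a\<close> maps \<open>xss + v\<close> to an element with the \<open>m\<close>-jet of \<open>x\<close>.
\<close>

lemma modality_eq:
  assumes a: "a \<in> filtered_aut L n" and p: "p \<in> lie_space (current S)" "coeff p 0 = xnil"
    and ap: "a (jet n ([:xss:] + p)) = jet n x" and mn: "m \<le> n"
  shows "modality L m n x = modality S m n p"
proof -
  interpret T: fd_lie_algebra "takiff L n" by (rule fd_lie_algebra_takiff)
  let ?T = "lie_space (takiff L n)"
  define q where "q = jet n ([:xss:] + p)"
  have qS: "q \<in> lie_space (takiff S n)"
    unfolding q_def by (rule takiff_add_xss[OF p(1)])
  have q: "q \<in> ?T"
    by (rule takiff_S_mem[OF qS])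
  have aq: "a q = jet n x" using ap by (simp add: q_def)
  have jet_x: "jet m x = jet m (a q)"
    using mn by (simp add: aq jet_jet)
  have jet_q: "jet m q = jet m ([:xss:] + p)"
    using mn by (simp add: q_def jet_jet)
  have jet_iff: "jet m ([:xss:] + u) = jet m ([:xss:] + v) \<longleftrightarrow> jet m u = jet m v" for u v :: "'a poly"
    by (simp add: jet_eq_iff)
  let ?M = "\<lambda>y. lie_dim (takiff L n) (lie_centralizer (takiff L n) (jet n y))"
  let ?N = "\<lambda>y. lie_dim (takiff S n) (lie_centralizer (takiff S n) (jet n y))"
  have aut_dim: "lie_dim (takiff L n) (lie_centralizer (takiff L n) (b u))
      = lie_dim (takiff L n) (lie_centralizer (takiff L n) u)"
    if "b \<in> filtered_aut L n" "u \<in> ?T" for b u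
    using that by (intro T.aut_dim_centralizer filtered_aut_lie_aut)
  have "?M ` {y \<in> lie_space (current L). jet m y = jet m x}
      = ?N ` {y \<in> lie_space (current S). jet m y = jet m p}"
  proof (intro equalityI subsetI)
    fix d assume "d \<in> ?M ` {y \<in> lie_space (current L). jet m y = jet m x}"
    then obtain y where y: "y \<in> lie_space (current L)" "jet m y = jet m x" "d = ?M y"
      by blast
    obtain u where u: "u \<in> ?T" "a u = jet n y"
      using T.aut_bij[OF filtered_aut_lie_aut[OF a]] jet_mem[OF y(1), of n]
      unfolding bij_betw_def by (metis imageE)
    have "jet m (a u) = jet m (a q)"
      using u(2) y(2) jet_x mn by (simp add: jet_jet)
    then have uq: "jet m u = jet m q"
      using filtered_aut_jet_iff[OF a u(1) q] by blast
    have q0: "coeff q 0 = x0"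
      by (simp add: q_def coeff_jet coeff_xss p(2) x0_eq)
    have "coeff u 0 = x0" "\<And>j. j \<le> m \<Longrightarrow> coeff u j \<in> lie_space S"
      using uq q0 qS unfolding jet_eq_iff takiff_mem_iff by auto
    then obtain b r where r: "b \<in> filtered_aut L n" "r \<in> lie_space (takiff S n)"
      "jet m r = jet m u" "b r = u"
      using normal_form[OF u(1) _ _ mn] by metis
    have r0: "coeff r 0 = x0"
      using r(3) uq q0 by (simp add: jet_eq_iff)
    define v where "v = r - [:xss:]"
    have v: "v \<in> lie_space (current S)" "coeff v 0 = xnil"
      unfolding v_def by (rule minus_xss_current[OF r(2) r0])+
    have rv: "r = [:xss:] + v" by (simp add: v_def)
    have "?N v = lie_dim (takiff L n) (lie_centralizer (takiff L n) r)"
      using dim_centralizer_eq[OF v] jet_takiff[OF r(2)] by (simp add: rv)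
    also have "\<dots> = d"
      using aut_dim[OF r(1) takiff_S_mem[OF r(2)]] aut_dim[OF a u(1)] by (simp add: r(4) u(2) y(3))
    finally have "d = ?N v" ..
    moreover have "jet m v = jet m p"
      using r(3) uq jet_q jet_iff rv by simp
    ultimately show "d \<in> ?N ` {y \<in> lie_space (current S). jet m y = jet m p}"
      using v(1) by blast
  next
    fix d assume "d \<in> ?N ` {y \<in> lie_space (current S). jet m y = jet m p}"
    then obtain v where v: "v \<in> lie_space (current S)" "jet m v = jet m p" "d = ?N v"
      by blast
    have v0: "coeff v 0 = xnil"
      using v(2) p(2) by (simp add: jet_eq_iff)
    define r where "r = jet n ([:xss:] + v)"
    have r: "r \<in> ?T"
      unfolding r_def by (rule takiff_S_mem[OF takiff_add_xss[OF v(1)]])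
    have "jet m r = jet m q"
      using v(2) mn by (simp add: r_def q_def jet_jet jet_iff)
    then have "jet m (a r) = jet m x"
      using filtered_aut_jet_iff[OF a r q] jet_x by simp
    moreover have ar: "a r \<in> ?T"
      by (rule T.aut_mem[OF filtered_aut_lie_aut[OF a] r])
    then have "a r \<in> lie_space (current L)"
      by (simp add: takiff_def)
    moreover have "d = ?M (a r)"
      using aut_dim[OF a r] dim_centralizer_eq[OF v(1) v0] v(3) jet_takiff[OF ar] by (simp add: r_def)
    ultimately show "d \<in> ?M ` {y \<in> lie_space (current L). jet m y = jet m x}"
      by blast
  qed
  moreover have "lie_dim (takiff L m) (lie_centralizer (takiff L m) (jet m x))
      = lie_dim (takiff S m) (lie_centralizer (takiff S m) (jet m p))"
    using filtered_aut_dim_centralizer[OF a mn q] dim_centralizer_eq[OF p]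
    by (simp add: jet_x jet_q)
  ultimately show ?thesis
    by (simp add: modality_def)
qed

end

section \<open>Reduction to the centralizer of the semisimple part\<close>

theorem proposition4p9:
  fixes L :: "'a::ab_group_add lie_alg"
    and x :: "'a poly" and n :: nat and xss xnil :: 'a and S :: "'a lie_alg"
  assumes "fd_lie_algebra L"
    and "reductive L"
    and "x \<in> lie_space (current L)"
    and "jordan_decomposition L (coeff x 0) xss xnil"
    and S: "S = centralizer_subalgebra L xss"
  shows "\<exists>xt \<in> lie_space (current S).
           coeff xt 0 = xnil \<and>
           adjoint_conjugate (takiff L n)
             (lie_centralizer (takiff L n) (jet n ([:xss:] + xt)))
             (lie_centralizer (takiff L n) (jet n x)) \<and>
           lie_centralizer (takiff L n) (jet n ([:xss:] + xt)) =
             lie_centralizer (takiff S n) (jet n xt) \<and>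
           (\<forall>m\<le>n. modality L m n x = modality S m n xt)"
proof -
  interpret fd_lie_algebra L by fact
  interpret J: jordan_decomposed L "coeff x 0" xss xnil
    by unfold_locales fact
  interpret T: fd_lie_algebra "takiff L n" by (rule fd_lie_algebra_takiff)
  have x0S: "coeff x 0 \<in> lie_space J.S"
    by (subst J.x0_eq) (intro J.S_add J.xss_S J.xnil_S)
  have jx: "jet n x \<in> lie_space (takiff L n)"
    by (rule jet_mem) fact
  obtain a q where a: "a \<in> algebraic_adjoint_group (takiff L n)" "a \<in> filtered_aut L n"
    and q: "q \<in> lie_space (takiff J.S n)" "jet 0 q = jet 0 (jet n x)" "a q = jet n x"
    by (rule J.normal_form[OF jx, of 0]) (use x0S in \<open>auto simp: coeff_jet\<close>)
  have q0: "coeff q 0 = coeff x 0"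
    using q(2) by (simp add: jet_eq_iff coeff_jet)
  define xt where "xt = q - [:xss:]"
  have xt: "xt \<in> lie_space (current J.S)" "coeff xt 0 = xnil"
    unfolding xt_def by (rule J.minus_xss_current[OF q(1) q0])+
  have jq: "jet n ([:xss:] + xt) = q"
    using jet_takiff[OF q(1)] by (simp add: xt_def)
  have "a ` lie_centralizer (takiff L n) q = lie_centralizer (takiff L n) (jet n x)"
    using T.aut_image_centralizer[OF filtered_aut_lie_aut[OF a(2)] J.takiff_S_mem[OF q(1)]]
    by (simp add: q(3))
  then have "adjoint_conjugate (takiff L n) (lie_centralizer (takiff L n) (jet n ([:xss:] + xt)))
      (lie_centralizer (takiff L n) (jet n x))"
    unfolding adjoint_conjugate_def jq using a(1) by blast
  moreover have "modality L m n x = modality J.S m n xt" if "m \<le> n" for m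
    using J.modality_eq[OF a(2) xt _ that] by (simp add: jq q(3))
  ultimately show ?thesis
    unfolding S using xt J.centralizer_eq[OF xt] by blast
qed

end
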